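(* Let $m\ge 0$ be a real number and let $n=\max\{k\ge 0:\ b_k\le m\}$ (with the convention $n=0$ if there is no such $k$), where $b_k=|B_k|-\tfrac12|\partial B_k|$. Let $S_m$ be the divisible sandpile cluster on the Sierpinski gasket graph $\mathsf{SG}$ with height function $h\equiv 1$ and initial mass configuration $\mu_0=m\delta_o$. Then $$B_{n-1}\subseteq S_m\subseteq B_n .$$
   Context: **Sierpinski gasket graph.** Let $G_0$ be the complete graph on the vertex set $\{(0,0),(1,0),(0,1)\}\subset\mathbb{Z}^2$. Recursively, $G_{k+1}$ is the union (of vertices and edges) of the three translates of $G_k$ by $(0,0)$, $(2^k,0)$ and $(0,2^k)$. Put $\mathsf{SG}^+=\bigcup_{k\ge0}G_k$, $\mathsf{SG}^-=-\mathsf{SG}^+$ (the image under $z\mapsto -z$), and $\mathsf{SG}=\mathsf{SG}^+\cup\mathsf{SG}^-$. This is an infinite 4-regular graph whose vertices are points of $\mathbb{Z}^2$; $\sim$ denotes adjacency and $o=(0,0)$. The ball of radius $n$ around $o$ in the graph metric is $B_n=\{(x,y)\in\mathsf{SG}:|x|+|y|\le n\}$ (empty for $n<0$). Its inner boundary is $\partial B_n=\{u\in B_n:\exists v\in\mathsf{SG}\setminus B_n,\ u\sim v\}$. **Divisible sandpile.** For $f:\mathsf{SG}\to\mathbb{R}$ let $\Delta f(x)=\frac14\sum_{y\sim x}f(y)-f(x)$. Let $h\equiv1$ be the height function and let $\mu_0:\mathsf{SG}\to\mathbb{R}_{\ge0}$ be a finitely supported initial sand distribution. The toppling operator is $T_x\mu=\mu+\max\{\mu(x)-h(x),0\}\,\Delta\delta_x$,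 where $\delta_x$ is the indicator function of $\{x\}$. Given a sequence $(x_k)_{k\ge1}$ of vertices containing every vertex infinitely often (a toppling sequence), put $\mu_k=T_{x_k}\mu_{k-1}$, and let $u_k(y)=\sum_{j\le k:\,x_j=y}(\mu_{j-1}(y)-\mu_j(y))$ be the total mass emitted from $y$ during the first $k$ topplings. As $k\to\infty$, $u_k$ increases pointwise to a finite limit $u$, the odometer function, which does not depend on the toppling sequence. The divisible sandpile cluster is $\{z\in\mathsf{SG}:u(z)>0\}$. *)

theory Defs
  imports Complex_Main "HOL-Library.Product_Plus" "HOL-Library.Indicator_Function" "HOL-Library.Countable"
begin

section \<open>The Sierpinski gasket graph\<close>

type_synonym vertex = "int \<times> int"

definition shifts :: "nat \<Rightarrow> vertex set" where
  "shifts k = {(0, 0), (2 ^ k, 0), (0, 2 ^ k)}"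

primrec G_verts :: "nat \<Rightarrow> vertex set" where
  "G_verts 0 = {(0, 0), (1, 0), (0, 1)}"
| "G_verts (Suc k) = (\<Union>t\<in>shifts k. (+) t ` G_verts k)"

text \<open>Edges are two-element sets of vertices.\<close>

primrec G_edges :: "nat \<Rightarrow> vertex set set" where
  "G_edges 0 = {e. e \<subseteq> G_verts 0 \<and> card e = 2}"
| "G_edges (Suc k) = (\<Union>t\<in>shifts k. (\<lambda>e. (+) t ` e) ` G_edges k)"

definition SG_pos :: "vertex set" where
  "SG_pos = (\<Union>k. G_verts k)"

definition SG_pos_edges :: "vertex set set" where
  "SG_pos_edges = (\<Union>k. G_edges k)"

definition SG :: "vertex set" where
  "SG = SG_pos \<union> uminus ` SG_pos"

definition SG_edges :: "vertex set set" where
  "SG_edges = SG_pos_edges \<union> (\<lambda>e. uminus ` e) ` SG_pos_edges"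

definition adj :: "vertex \<Rightarrow> vertex \<Rightarrow> bool" where
  "adj u v \<longleftrightarrow> {u, v} \<in> SG_edges"

text \<open>The radius is an integer, so that balls of negative radius are available (they are empty).
  That these are the balls of the graph metric is \<open>SG_ball_graph_metric\<close> below.\<close>

definition SG_ball :: "int \<Rightarrow> vertex set" where
  "SG_ball n = {(x, y) \<in> SG. \<bar>x\<bar> + \<bar>y\<bar> \<le> n}"

definition inner_boundary :: "int \<Rightarrow> vertex set" where
  "inner_boundary n = {u \<in> SG_ball n. \<exists>v \<in> SG - SG_ball n. adj u v}"

definition b_vol :: "nat \<Rightarrow> real" where
  "b_vol k = real (card (SG_ball (int k))) - real (card (inner_boundary (int k))) / 2"


section \<open>The divisible sandpile\<close>

text \<open>Functions on \<open>SG\<close> are represented by functions on the whole of \<open>\<int>\<^sup>2\<close>.  Points outside \<open>SG\<close> have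
  no neighbours, and a configuration that vanishes there keeps doing so under toppling at
  vertices of \<open>SG\<close>.\<close>

definition Laplacian :: "(vertex \<Rightarrow> real) \<Rightarrow> vertex \<Rightarrow> real" where
  "Laplacian f x = (1 / 4) * (\<Sum>y | adj x y. f y) - f x"

definition topple :: "(vertex \<Rightarrow> real) \<Rightarrow> vertex \<Rightarrow> (vertex \<Rightarrow> real) \<Rightarrow> vertex \<Rightarrow> real" where
  "topple h x \<mu> = (\<lambda>y. \<mu> y + max (\<mu> x - h x) 0 * Laplacian (indicator {x}) y)"

text \<open>Toppling sequences are indexed from 1; the value at index 0 is never used.\<close>

definition toppling_sequence :: "(nat \<Rightarrow> vertex) \<Rightarrow> bool" where
  "toppling_sequence xs \<longleftrightarrow>
     (\<forall>k\<ge>1. xs k \<in> SG) \<and> (\<forall>v\<in>SG. infinite {k. k \<ge> 1 \<and> xs k = v})"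

primrec sand :: "(vertex \<Rightarrow> real) \<Rightarrow> (vertex \<Rightarrow> real) \<Rightarrow> (nat \<Rightarrow> vertex) \<Rightarrow> nat \<Rightarrow> vertex \<Rightarrow> real" where
  "sand h \<mu>0 xs 0 = \<mu>0"
| "sand h \<mu>0 xs (Suc k) = topple h (xs (Suc k)) (sand h \<mu>0 xs k)"

definition emitted ::
  "(vertex \<Rightarrow> real) \<Rightarrow> (vertex \<Rightarrow> real) \<Rightarrow> (nat \<Rightarrow> vertex) \<Rightarrow> nat \<Rightarrow> vertex \<Rightarrow> real" where
  "emitted h \<mu>0 xs k y =
     (\<Sum>j | 1 \<le> j \<and> j \<le> k \<and> xs j = y. sand h \<mu>0 xs (j - 1) y - sand h \<mu>0 xs j y)"

definition odometer ::
  "(vertex \<Rightarrow> real) \<Rightarrow> (vertex \<Rightarrow> real) \<Rightarrow> (nat \<Rightarrow> vertex) \<Rightarrow> vertex \<Rightarrow> real" where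
  "odometer h \<mu>0 xs y = lim (\<lambda>k. emitted h \<mu>0 xs k y)"

definition cluster ::
  "(vertex \<Rightarrow> real) \<Rightarrow> (vertex \<Rightarrow> real) \<Rightarrow> (nat \<Rightarrow> vertex) \<Rightarrow> vertex set" where
  "cluster h \<mu>0 xs = {z \<in> SG. odometer h \<mu>0 xs z > 0}"


section \<open>Consistency checks\<close>

lemma G_verts_nonneg: "(x, y) \<in> G_verts k \<Longrightarrow> 0 \<le> x \<and> 0 \<le> y"
  by (induction k arbitrary: x y) (auto simp: shifts_def)

lemma G_verts_corners: "(2 ^ k, 0) \<in> G_verts k \<and> (0, 2 ^ k) \<in> G_verts k"
proof (induction k)
  case (Suc k)
  have "(2 ^ k, 0) + (2 ^ k, 0) = (2 ^ Suc k :: int, 0 :: int)"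
    "(0, 2 ^ k) + (0, 2 ^ k) = (0 :: int, 2 ^ Suc k :: int)" by simp_all
  moreover have "(2 ^ k, 0) + (2 ^ k, 0) \<in> G_verts (Suc k)"
    "(0, 2 ^ k) + (0, 2 ^ k) \<in> G_verts (Suc k)"
    using Suc unfolding G_verts.simps shifts_def by blast+
  ultimately show ?case by simp
qed simp

lemma G_edges_step:
  "{(x, y), (x', y')} \<in> G_edges k \<Longrightarrow>
     (x, y) \<in> G_verts k \<and> (x', y') \<in> G_verts k \<and> x' + y' \<le> x + y + 1"
proof (induction k arbitrary: x y x' y')
  case 0
  then show ?case by auto
next
  case (Suc k)
  then obtain t e where t: "t \<in> shifts k" and e: "e \<in> G_edges k"
    and eq: "{(x, y), (x', y')} = (+) t ` e" by auto
  obtain p q where pq: "t = (p, q)" by force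
  have "e = (+) (- t) ` (+) t ` e" by (simp add: image_image)
  also have "\<dots> = {(x - p, y - q), (x' - p, y' - q)}"
    unfolding eq[symmetric] by (simp add: pq)
  finally have "e = {(x - p, y - q), (x' - p, y' - q)}" .
  with Suc.IH[of "x - p" "y - q" "x' - p" "y' - q"] e
  have *: "(x - p, y - q) \<in> G_verts k" "(x' - p, y' - q) \<in> G_verts k" "x' + y' \<le> x + y + 1" by simp_all
  have "(x, y) = t + (x - p, y - q)" "(x', y') = t + (x' - p, y' - q)" by (simp_all add: pq)
  with * t show ?case unfolding G_verts.simps by blast
qed

lemma G_pred:
  "v \<in> G_verts k \<Longrightarrow> v \<noteq> (0, 0) \<Longrightarrow>
     \<exists>u. {u, v} \<in> G_edges k \<and> fst u + snd u = fst v + snd v - 1"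
proof (induction k arbitrary: v)
  case 0
  then have "v = (1, 0) \<or> v = (0, 1)" by auto
  then show ?case by (intro exI[of _ "(0, 0)"]) auto
next
  case (Suc k)
  have lift: "\<exists>u. {u, t + w} \<in> G_edges (Suc k) \<and> fst u + snd u = fst (t + w) + snd (t + w) - 1"
    if t: "t \<in> shifts k" and w: "w \<in> G_verts k" "w \<noteq> (0, 0)" for t w
  proof -
    obtain u where u: "{u, w} \<in> G_edges k" "fst u + snd u = fst w + snd w - 1"
      using Suc.IH w by blast
    have "{t + u, t + w} = (+) t ` {u, w}" by simp
    with t u(1) have "{t + u, t + w} \<in> G_edges (Suc k)" by (auto simp del: image_insert)
    with u(2) show ?thesis by (intro exI[of _ "t + u"]) auto
  qed
  from Suc.prems(1) obtain t w where t: "t \<in> shifts k" and w: "w \<in> G_verts k" and v: "v = t + w"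
    by auto
  show ?case
  proof (cases "w = (0, 0)")
    case False
    then show ?thesis using lift t w v by blast
  next
    case True
    then have vt: "v = (0, 0) + t" by (simp add: v add.commute)
    have "t \<noteq> (0, 0)" using Suc.prems(2) vt by force
    then have "t \<in> G_verts k" using t G_verts_corners[of k] by (auto simp: shifts_def)
    then show ?thesis using lift[of "(0, 0)" t] \<open>t \<noteq> (0, 0)\<close> vt unfolding shifts_def by blast
  qed
qed

lemma adj_sym: "adj u v \<longleftrightarrow> adj v u"
  by (simp add: adj_def insert_commute)

definition taxi :: "vertex \<Rightarrow> int" where
  "taxi v = \<bar>fst v\<bar> + \<bar>snd v\<bar>"

lemma taxi_uminus [simp]: "taxi (- v) = taxi v"
  by (simp add: taxi_def)

lemma SG_ball_taxi: "SG_ball n = {v \<in> SG. taxi v \<le> n}"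
  by (auto simp: SG_ball_def taxi_def)

lemma adj_cases:
  assumes "adj u v"
  obtains k where "{u, v} \<in> G_edges k" | k where "{- u, - v} \<in> G_edges k"
proof -
  from assms consider "{u, v} \<in> SG_pos_edges" | e where "e \<in> SG_pos_edges" "{u, v} = uminus ` e"
    by (auto simp: adj_def SG_edges_def)
  then show ?thesis
  proof cases
    case 1
    then show ?thesis using that by (auto simp: SG_pos_edges_def)
  next
    case 2
    have "e = uminus ` uminus ` e" by (simp add: image_image)
    also have "\<dots> = {- u, - v}" using 2(2)[symmetric] by simp
    finally show ?thesis using that 2(1) by (auto simp: SG_pos_edges_def)
  qed
qed

lemma adj_step:
  assumes "adj u v"
  shows "u \<in> SG \<and> v \<in> SG \<and> taxi v \<le> taxi u + 1"
proof -
  have *: "u \<in> G_verts k \<and> v \<in> G_verts k \<and> taxi v \<le> taxi u + 1" if "{u, v} \<in> G_edges k" for u v k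
    using that G_edges_step[of "fst u" "snd u" "fst v" "snd v" k]
      G_verts_nonneg[of "fst u" "snd u" k] G_verts_nonneg[of "fst v" "snd v" k]
    by (auto simp: taxi_def)
  have neg: "w \<in> uminus ` SG_pos" if "- w \<in> SG_pos" for w
    using that by (metis image_eqI minus_minus)
  from assms show ?thesis
  proof (cases rule: adj_cases)
    case (1 k)
    then show ?thesis using *[of u v k] by (auto simp: SG_def SG_pos_def)
  next
    case (2 k)
    then show ?thesis using *[of "- u" "- v" k] neg[of u] neg[of v] by (auto simp: SG_def SG_pos_def)
  qed
qed

lemma SG_pred:
  assumes "v \<in> SG" "v \<noteq> (0, 0)"
  shows "\<exists>u. adj u v \<and> taxi u = taxi v - 1"
proof -
  have *: "\<exists>u. {u, v} \<in> SG_pos_edges \<and> taxi u = taxi v - 1" if v: "v \<in> SG_pos" "v \<noteq> (0, 0)" for v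
  proof -
    from v(1) obtain k where k: "v \<in> G_verts k" by (auto simp: SG_pos_def)
    from G_pred[OF k v(2)] obtain u where u: "{u, v} \<in> G_edges k"
      "fst u + snd u = fst v + snd v - 1" by blast
    have "taxi u = taxi v - 1"
      using u G_edges_step[of "fst u" "snd u" "fst v" "snd v" k]
        G_verts_nonneg[of "fst u" "snd u" k] G_verts_nonneg[of "fst v" "snd v" k]
      by (auto simp: taxi_def)
    with u(1) show ?thesis unfolding SG_pos_edges_def by blast
  qed
  show ?thesis
  proof (cases "v \<in> SG_pos")
    case True
    then show ?thesis using *[OF True assms(2)] by (auto simp: adj_def SG_edges_def)
  next
    case False
    then obtain w where w: "w \<in> SG_pos" "v = - w" using assms(1) by (auto simp: SG_def)
    then have "w \<noteq> (0, 0)" using assms(2) by auto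
    from *[OF w(1) this] obtain u where u: "{u, w} \<in> SG_pos_edges" "taxi u = taxi w - 1" by blast
    have "{- u, v} = uminus ` {u, w}" using w(2) by simp
    then have "adj (- u) v" using u(1) unfolding adj_def SG_edges_def by blast
    then show ?thesis using u(2) w(2) by (intro exI[of _ "- u"]) simp
  qed
qed

lemma zero_in_SG: "(0, 0) \<in> SG"
proof -
  have "(0, 0) \<in> G_verts 0" by simp
  then show ?thesis unfolding SG_def SG_pos_def by blast
qed

theorem SG_ball_graph_metric:
  "SG_ball (int n) = {v. \<exists>k\<le>n. ((0, 0), v) \<in> {(u, v). adj u v} ^^ k}"
proof (intro set_eqI iffI)
  fix v assume "v \<in> SG_ball (int n)"
  then show "v \<in> {v. \<exists>k\<le>n. ((0, 0), v) \<in> {(u, v). adj u v} ^^ k}"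
  proof (induction n arbitrary: v)
    case 0
    then show ?case by (auto simp: SG_ball_def)
  next
    case (Suc n)
    show ?case
    proof (cases "v = (0, 0)")
      case True
      then show ?thesis by (auto intro!: exI[of _ 0])
    next
      case False
      with Suc.prems obtain u where u: "adj u v" "taxi u = taxi v - 1"
        using SG_pred[of v] unfolding SG_ball_taxi by blast
      then have "u \<in> SG_ball (int n)" using Suc.prems adj_step by (auto simp: SG_ball_taxi)
      with Suc.IH obtain k where "k \<le> n" "((0, 0), u) \<in> {(u, v). adj u v} ^^ k" by blast
      then show ?thesis using u(1) by (auto intro!: exI[of _ "Suc k"])
    qed
  qed
next
  have *: "v \<in> SG \<and> taxi v \<le> int k" if "((0, 0), v) \<in> {(u, v). adj u v} ^^ k" for v k
    using that
  proof (induction k arbitrary: v)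
    case 0
    then show ?case using zero_in_SG by (auto simp: taxi_def)
  next
    case (Suc k)
    then obtain u where "((0, 0), u) \<in> {(u, v). adj u v} ^^ k" "adj u v" by auto
    then show ?case using Suc.IH[of u] adj_step[of u v] by auto
  qed
  fix v assume "v \<in> {v. \<exists>k\<le>n. ((0, 0), v) \<in> {(u, v). adj u v} ^^ k}"
  then show "v \<in> SG_ball (int n)" using * by (fastforce simp: SG_ball_taxi)
qed

lemma toppling_sequence_exists: "\<exists>xs. toppling_sequence xs"
proof -
  define f where "f = (\<lambda>k. (let v = fst (from_nat k :: vertex \<times> nat) in if v \<in> SG then v else (0, 0)))"
  have "infinite {k. k \<ge> 1 \<and> f k = v}" if "v \<in> SG" for v
  proof -
    have "inj (\<lambda>i::nat. to_nat (v, i))" by (intro injI) simp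
    then have "infinite (range (\<lambda>i::nat. to_nat (v, i)))"
      using finite_imageD infinite_UNIV_nat by blast
    then have "infinite (range (\<lambda>i::nat. to_nat (v, i)) - {0})" by simp
    moreover have "range (\<lambda>i::nat. to_nat (v, i)) - {0} \<subseteq> {k. k \<ge> 1 \<and> f k = v}"
      using that by (auto simp: f_def)
    ultimately show ?thesis using finite_subset by blast
  qed
  moreover have "f k \<in> SG" for k using zero_in_SG by (simp add: f_def Let_def)
  ultimately show ?thesis unfolding toppling_sequence_def by blast
qed

end

theory Submission
  imports Defs
begin

text \<open>
  The theorem rests on an exact solution for the masses \<open>m = b_vol n\<close> with \<open>n \<ge> 1\<close>.  For these there is a function
  \<open>u\<^sub>n \<ge> 0\<close> (\<open>ball_odometer\<close>) which is positive exactly on \<open>B\<^sub>n\<^sub>-\<^sub>1\<close> and for which \<open>b_vol n \<cdot> \<delta>\<^sub>o + \<Delta>u\<^sub>n\<close> is 1 on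
  \<open>B\<^sub>n\<close>, apart from \<open>1/2\<close> on the inner boundary, and 0 elsewhere.  General masses are compared with the two
  nearest exact solutions.

  If \<open>m < b_vol (n + 1)\<close>, then \<open>u\<^sub>n\<^sub>+\<^sub>1\<close> stabilizes \<open>m \<cdot> \<delta>\<^sub>o\<close>, and the least action principle
  (\<open>emitted_le_stabilizing\<close>) bounds the odometer by \<open>u\<^sub>n\<^sub>+\<^sub>1\<close>, which is supported on \<open>B\<^sub>n\<close>.  If \<open>b_vol n \<le> m\<close>, then
  \<open>u\<^sub>n\<close> minus the odometer is subharmonic on \<open>B\<^sub>n\<^sub>-\<^sub>1\<close> and not positive outside, so by the maximum principle
  (\<open>subharmonic_nonpos\<close>) the odometer is at least \<open>u\<^sub>n\<close> and hence positive on \<open>B\<^sub>n\<^sub>-\<^sub>1\<close>.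

  The exact solution exists because of self-similarity.  By symmetry it suffices to treat the
  positive cone.  For \<open>n = 2\<^sup>k + j\<close> with \<open>1 \<le> j \<le> 2\<^sup>k\<close> the ball consists there of \<open>G\<^sub>k\<close> with two copies of
  the ball of radius \<open>j\<close> attached at its two upper corners.  On the copies one takes the solution for
  \<open>j\<close>, and on \<open>G\<^sub>k\<close> the solution of \<open>\<Delta>f = 1\<close> with the matching corner values (\<open>profile\<close>, given by an
  explicit harmonic extension rule); the value at the origin is the one free parameter, and it is
  adjusted so that the sand arriving at the corners is exactly what is used there and in the copies
  (\<open>cone_odometer_step\<close>).  The initial mass that belongs to the solution is then found from
  conservation of mass rather than from the recursion (\<open>ball_odometer_origin\<close>).
\<close>

section \<open>The triangles of the gasket\<close>

text \<open>The graph is a union of edge-disjoint unit triangles \<open>{a, a + (1, 0), a + (0, 1)}\<close>.  Working with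
  triangles instead of edges makes the Laplacian additive over the three copies of \<open>G\<^sub>k\<close> that form
  \<open>G\<^sub>k\<^sub>+\<^sub>1\<close>; the set \<open>cells k\<close> collects their lower left corners \<open>a\<close>.\<close>

primrec cells :: "nat \<Rightarrow> vertex set" where
  "cells 0 = {(0, 0)}"
| "cells (Suc k) = (\<Union>t\<in>shifts k. (+) t ` cells k)"

definition cell :: "vertex \<Rightarrow> vertex set" where
  "cell a = {a, a + (1, 0), a + (0, 1)}"

definition level :: "vertex \<Rightarrow> int" where
  "level x = fst x + snd x"

lemma in_translate_iff: "x \<in> (+) t ` A \<longleftrightarrow> x - t \<in> A" for x t :: vertex
proof
  assume "x - t \<in> A"
  then have "t + (x - t) \<in> (+) t ` A" by (rule imageI)
  then show "x \<in> (+) t ` A" by simp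
qed auto

lemma diff_zero_pair [simp]: "x - (0, 0) = x" for x :: vertex
  by (cases x) simp

lemma G_verts_Suc_iff:
  "x \<in> G_verts (Suc k) \<longleftrightarrow>
     x \<in> G_verts k \<or> x - (2 ^ k, 0) \<in> G_verts k \<or> x - (0, 2 ^ k) \<in> G_verts k"
  by (simp add: shifts_def in_translate_iff)

lemma cells_Suc_iff:
  "x \<in> cells (Suc k) \<longleftrightarrow>
     x \<in> cells k \<or> x - (2 ^ k, 0) \<in> cells k \<or> x - (0, 2 ^ k) \<in> cells k"
  by (simp add: shifts_def in_translate_iff)

lemma zero_in_G_verts: "(0, 0) \<in> G_verts k"
  by (induction k) (simp_all only: G_verts_Suc_iff, auto)

lemma zero_in_cells: "(0, 0) \<in> cells k"
  by (induction k) (simp_all only: cells_Suc_iff, auto)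

lemma G_verts_bounds:
  "x \<in> G_verts k \<Longrightarrow> 0 \<le> fst x \<and> 0 \<le> snd x \<and> level x \<le> 2 ^ k"
proof (induction k arbitrary: x)
  case 0
  then show ?case by (auto simp: level_def)
next
  case (Suc k)
  have "(0::int) < 2 ^ k" by simp
  with Suc.prems Suc.IH[of x] Suc.IH[of "x - (2 ^ k, 0)"] Suc.IH[of "x - (0, 2 ^ k)"] show ?case
    by (auto simp: G_verts_Suc_iff level_def simp del: G_verts.simps)
qed

lemma cells_bounds:
  "x \<in> cells k \<Longrightarrow> 0 \<le> fst x \<and> 0 \<le> snd x \<and> level x < 2 ^ k"
proof (induction k arbitrary: x)
  case 0
  then show ?case by (auto simp: level_def)
next
  case (Suc k)
  have "(0::int) < 2 ^ k" by simp
  with Suc.prems Suc.IH[of x] Suc.IH[of "x - (2 ^ k, 0)"] Suc.IH[of "x - (0, 2 ^ k)"] show ?case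
    by (auto simp: cells_Suc_iff level_def simp del: cells.simps)
qed

lemma cell_subset_G_verts: "a \<in> cells k \<Longrightarrow> cell a \<subseteq> G_verts k"
proof (induction k arbitrary: a)
  case 0
  then show ?case by (auto simp: cell_def)
next
  case (Suc k)
  have "cell (a - t) = (\<lambda>x. x - t) ` cell a" for t :: vertex
    by (auto simp: cell_def algebra_simps)
  then have *: "y - t \<in> G_verts k" if "a - t \<in> cells k" "y \<in> cell a" for t y
    using Suc.IH[OF that(1)] that(2) by blast
  have "a \<in> cells k \<or> a - (2 ^ k, 0) \<in> cells k \<or> a - (0, 2 ^ k) \<in> cells k"
    using Suc.prems by (simp only: cells_Suc_iff)
  then show ?case
    using *[of "(0, 0)"] *[of "(2 ^ k, 0)"] *[of "(0, 2 ^ k)"]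
    by (auto simp: G_verts_Suc_iff simp del: G_verts.simps)
qed

text \<open>Inclusion-exclusion: by the bounds above, two of the three copies meet only in a common corner,
  and no point lies in all three.\<close>

lemma G_verts_Suc_indicator:
  "(of_bool (x \<in> G_verts (Suc k)) :: real) =
     of_bool (x \<in> G_verts k) + of_bool (x - (2 ^ k, 0) \<in> G_verts k) + of_bool (x - (0, 2 ^ k) \<in> G_verts k)
     - of_bool (x = (2 ^ k, 0)) - of_bool (x = (0, 2 ^ k)) - of_bool (x = (2 ^ k, 2 ^ k))"
proof -
  define N :: int where "N = 2 ^ k"
  have "N > 0" by (simp add: N_def)
  have corners: "(0, 0) \<in> G_verts k" "(N, 0) \<in> G_verts k" "(0, N) \<in> G_verts k"
    using zero_in_G_verts G_verts_corners by (simp_all add: N_def)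
  have bounds: "0 \<le> a" "0 \<le> b" "a + b \<le> N" if "(a, b) \<in> G_verts k" for a b
    using G_verts_bounds[OF that] by (simp_all add: N_def level_def)
  obtain a b where x: "x = (a, b)" by (cases x)
  have overlap: "(a, b) \<in> G_verts k \<and> (a - N, b) \<in> G_verts k \<longleftrightarrow> a = N \<and> b = 0"
    using bounds[of a b] bounds[of "a - N" b] corners by auto
  have overlap': "(a, b) \<in> G_verts k \<and> (a, b - N) \<in> G_verts k \<longleftrightarrow> a = 0 \<and> b = N"
    using bounds[of a b] bounds[of a "b - N"] corners by auto
  have overlap'': "(a - N, b) \<in> G_verts k \<and> (a, b - N) \<in> G_verts k \<longleftrightarrow> a = N \<and> b = N"
    using bounds[of "a - N" b] bounds[of a "b - N"] corners by auto
  have "\<not> ((a, b) \<in> G_verts k \<and> (a - N, b) \<in> G_verts k \<and> (a, b - N) \<in> G_verts k)"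
    using overlap overlap' \<open>N > 0\<close> by linarith
  then have "(of_bool ((a, b) \<in> G_verts k \<or> (a - N, b) \<in> G_verts k \<or> (a, b - N) \<in> G_verts k) :: real) =
     of_bool ((a, b) \<in> G_verts k) + of_bool ((a - N, b) \<in> G_verts k) + of_bool ((a, b - N) \<in> G_verts k)
     - of_bool (a = N \<and> b = 0) - of_bool (a = 0 \<and> b = N) - of_bool (a = N \<and> b = N)"
    unfolding overlap[symmetric] overlap'[symmetric] overlap''[symmetric]
    by (auto simp only: of_bool_def split: if_split)
  then show ?thesis
    unfolding G_verts_Suc_iff x by (simp add: N_def)
qed

text \<open>In contrast to vertices, triangles are never shared between the three copies, so that the
  indicator is additive without a correction.\<close>

lemma cells_Suc_indicator:
  "(of_bool (x \<in> cells (Suc k)) :: real) =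
     of_bool (x \<in> cells k) + of_bool (x - (2 ^ k, 0) \<in> cells k) + of_bool (x - (0, 2 ^ k) \<in> cells k)"
proof -
  have "\<not> (x \<in> cells k \<and> x - (2 ^ k, 0) \<in> cells k)"
      "\<not> (x \<in> cells k \<and> x - (0, 2 ^ k) \<in> cells k)"
      "\<not> (x - (2 ^ k, 0) \<in> cells k \<and> x - (0, 2 ^ k) \<in> cells k)"
    by (cases x; auto dest!: cells_bounds simp: level_def)+
  then show ?thesis by (auto simp: cells_Suc_iff simp del: cells.simps)
qed

text \<open>The triangles in which \<open>x\<close> is one of the two upper corners, i.e. those that connect \<open>x\<close> to the
  previous level.\<close>

definition cells_below :: "vertex set \<Rightarrow> vertex \<Rightarrow> real" where
  "cells_below S x = of_bool (x - (1, 0) \<in> S) + of_bool (x - (0, 1) \<in> S)"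

lemma cells_below_Suc:
  "cells_below (cells (Suc k)) x = cells_below (cells k) x
     + cells_below (cells k) (x - (2 ^ k, 0)) + cells_below (cells k) (x - (0, 2 ^ k))"
  unfolding cells_below_def cells_Suc_indicator by (simp add: diff_right_commute)

lemma diff_corner_iff:
  fixes x :: vertex
  shows "x - (2 ^ k, 0) = (0, 0) \<longleftrightarrow> x = (2 ^ k, 0)" "x - (0, 2 ^ k) = (0, 0) \<longleftrightarrow> x = (0, 2 ^ k)"
    "x - (2 ^ k, 0) = (2 ^ k, 0) \<longleftrightarrow> x = (2 ^ Suc k, 0)"
    "x - (0, 2 ^ k) = (0, 2 ^ k) \<longleftrightarrow> x = (0, 2 ^ Suc k)"
    "x - (2 ^ k, 0) = (0, 2 ^ k) \<longleftrightarrow> x = (2 ^ k, 2 ^ k)"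
    "x - (0, 2 ^ k) = (2 ^ k, 0) \<longleftrightarrow> x = (2 ^ k, 2 ^ k)"
  by (cases x; auto)+

text \<open>The source of 4-regularity.  A corner of \<open>G\<^sub>k\<close> lies in one triangle only; its second triangle belongs to
  the adjacent copy of \<open>G\<^sub>k\<close>, or to the other half of the graph in the case of the origin.\<close>

lemma number_of_cells:
  "of_bool (x \<in> cells k) + cells_below (cells k) x =
     2 * of_bool (x \<in> G_verts k)
     - of_bool (x = (0, 0)) - of_bool (x = (2 ^ k, 0)) - of_bool (x = (0, 2 ^ k))"
proof (induction k arbitrary: x)
  case 0
  show ?case by (cases x) (auto simp: cells_below_def)
next
  case (Suc k)
  \<comment> \<open>The corners of the three copies cancel against the overlaps in the vertex indicator.\<close>
  have sum_step: "a + a' + a'' + (b + b' + b'') = 2 * (v + v' + v'' - p - q - r) - w - p' - q'"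
    if "a + b = 2 * v - w - p - q" "a' + b' = 2 * v' - p - p' - r" "a'' + b'' = 2 * v'' - q - r - q'"
    for a a' a'' b b' b'' v v' v'' w p p' q q' r :: real
    using that by (simp add: algebra_simps)
  show ?case
    unfolding cells_below_Suc cells_Suc_indicator G_verts_Suc_indicator
    by (rule sum_step[OF Suc[of x] Suc[of "x - (2 ^ k, 0)", unfolded diff_corner_iff] Suc[of "x - (0, 2 ^ k)", unfolded diff_corner_iff]])
qed

section \<open>The Laplacian as a sum over triangles\<close>

text \<open>Each of the three summands belongs to one of the triangles that may contain \<open>x\<close>.  For a vertex in two
  triangles of \<open>S\<close> this is the graph Laplacian, while at a corner it is
  only the share of the triangle inside; the shares of adjacent copies add up.\<close>

definition cell_lap :: "vertex set \<Rightarrow> (vertex \<Rightarrow> real) \<Rightarrow> vertex \<Rightarrow> real" where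
  "cell_lap S f x =
     (of_bool (x \<in> S) * (f (x + (1, 0)) + f (x + (0, 1)) - 2 * f x)
    + of_bool (x - (1, 0) \<in> S) * (f (x - (1, 0)) + f (x - (1, 0) + (0, 1)) - 2 * f x)
    + of_bool (x - (0, 1) \<in> S) * (f (x - (0, 1)) + f (x - (0, 1) + (1, 0)) - 2 * f x)) / 4"

lemma cell_lap_cong:
  assumes "\<And>y. y \<in> G_verts k \<Longrightarrow> f y = g y"
  shows "cell_lap (cells k) f x = cell_lap (cells k) g x"
proof -
  have *: "f y = g y" if "a \<in> cells k" "y \<in> cell a" for a y
    using assms cell_subset_G_verts that by blast
  have "f x = g x" "f (x + (1, 0)) = g (x + (1, 0))" "f (x + (0, 1)) = g (x + (0, 1))" if "x \<in> cells k"
    using *[OF that] by (simp_all add: cell_def)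
  moreover have "f x = g x" "f (x - (1, 0)) = g (x - (1, 0))"
    "f (x - (1, 0) + (0, 1)) = g (x - (1, 0) + (0, 1))" if "x - (1, 0) \<in> cells k"
    using *[OF that] by (simp_all add: cell_def)
  moreover have "f x = g x" "f (x - (0, 1)) = g (x - (0, 1))"
    "f (x - (0, 1) + (1, 0)) = g (x - (0, 1) + (1, 0))" if "x - (0, 1) \<in> cells k"
    using *[OF that] by (simp_all add: cell_def)
  ultimately show ?thesis unfolding cell_lap_def by auto
qed

lemma cell_lap_translate: "cell_lap ((+) t ` S) f x = cell_lap S (\<lambda>y. f (t + y)) (x - t)"
proof -
  have "x - (1, 0) - t = x - t - (1, 0)" "x - (0, 1) - t = x - t - (0, 1)"
    "t + (x - t + (1, 0)) = x + (1, 0)" "t + (x - t + (0, 1)) = x + (0, 1)" "t + (x - t) = x"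
    "t + (x - t - (1, 0)) = x - (1, 0)" "t + (x - t - (0, 1)) = x - (0, 1)"
    "t + (x - t - (1, 0) + (0, 1)) = x - (1, 0) + (0, 1)"
    "t + (x - t - (0, 1) + (1, 0)) = x - (0, 1) + (1, 0)"
    by (simp_all add: prod_eq_iff)
  then show ?thesis
    unfolding cell_lap_def in_translate_iff by (simp only:)
qed

text \<open>The renormalisation identity that drives all recursive constructions below.\<close>

lemma cell_lap_Suc:
  "cell_lap (cells (Suc k)) f x = cell_lap (cells k) f x
     + cell_lap (cells k) (\<lambda>y. f ((2 ^ k, 0) + y)) (x - (2 ^ k, 0))
     + cell_lap (cells k) (\<lambda>y. f ((0, 2 ^ k) + y)) (x - (0, 2 ^ k))"
  unfolding cell_lap_translate[symmetric]
  by (simp only: cell_lap_def cells_Suc_indicator in_translate_iff distrib_right add_divide_distrib add_ac)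

section \<open>Functions with Laplacian 1 on a triangle\<close>

text \<open>The solution of \<open>\<Delta>f = 1\<close> inside \<open>G\<^sub>k\<close> with values \<open>a\<close>, \<open>b\<close>, \<open>c\<close> at the corners \<open>(0, 0)\<close>, \<open>(2\<^sup>k, 0)\<close>, \<open>(0, 2\<^sup>k)\<close>.
  The values \<open>p\<close>, \<open>q\<close>, \<open>r\<close> at the three points where the copies of \<open>G\<^sub>k\<close> in \<open>G\<^sub>k\<^sub>+\<^sub>1\<close> meet follow the classical
  \<open>(2/5, 2/5, 1/5)\<close> rule of harmonic extension on the gasket, lowered by the constant \<open>2 \<cdot> 5\<^sup>k\<close> that turns
  the Laplacian at these points from 0 into 1.\<close>

primrec profile :: "nat \<Rightarrow> real \<Rightarrow> real \<Rightarrow> real \<Rightarrow> vertex \<Rightarrow> real" where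
  "profile 0 a b c x = (if x = (0, 0) then a else if x = (1, 0) then b else if x = (0, 1) then c else 0)"
| "profile (Suc k) a b c x =
    (let p = (2 * a + 2 * b + c) / 5 - 2 * 5 ^ k;
         q = (2 * a + b + 2 * c) / 5 - 2 * 5 ^ k;
         r = (a + 2 * b + 2 * c) / 5 - 2 * 5 ^ k
     in if x \<in> G_verts k then profile k a p q x
        else if x - (2 ^ k, 0) \<in> G_verts k then profile k p b r (x - (2 ^ k, 0))
        else profile k q r c (x - (0, 2 ^ k)))"

lemma profile_corners:
  "profile k a b c (0, 0) = a \<and> profile k a b c (2 ^ k, 0) = b \<and> profile k a b c (0, 2 ^ k) = c"
proof (induction k arbitrary: a b c)
  case (Suc k)
  have out: "(2 ^ Suc k, 0) \<notin> G_verts k" "(0, 2 ^ Suc k) \<notin> G_verts k" "(- (2 ^ k), 2 ^ Suc k) \<notin> G_verts k"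
    using G_verts_bounds by (force simp: level_def)+
  have diff: "(2 ^ Suc k, 0) - (2 ^ k, 0) = (2 ^ k :: int, 0 :: int)"
    "(0, 2 ^ Suc k) - (2 ^ k, 0) = (- (2 ^ k) :: int, 2 ^ Suc k :: int)"
    "(0, 2 ^ Suc k) - (0, 2 ^ k) = (0 :: int, 2 ^ k :: int)" by simp_all
  have "profile (Suc k) a b c (0, 0) = a"
    by (simp only: profile.simps Let_def zero_in_G_verts if_True Suc.IH)
  moreover have "profile (Suc k) a b c (2 ^ Suc k, 0) = b"
    by (simp only: profile.simps Let_def out diff G_verts_corners if_True if_False Suc.IH)
  moreover have "profile (Suc k) a b c (0, 2 ^ Suc k) = c"
    by (simp only: profile.simps Let_def out diff G_verts_corners if_True if_False Suc.IH)
  ultimately show ?case by blast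
qed simp_all

text \<open>Neighbouring pieces agree at the corner that they share, so the case distinction in the
  definition prefers no copy.\<close>

lemma profile_pieces:
  fixes a b c :: real and k :: nat
  defines "p \<equiv> (2 * a + 2 * b + c) / 5 - 2 * 5 ^ k"
    and "q \<equiv> (2 * a + b + 2 * c) / 5 - 2 * 5 ^ k"
    and "r \<equiv> (a + 2 * b + 2 * c) / 5 - 2 * 5 ^ k"
  assumes x: "x \<in> G_verts k"
  shows "profile (Suc k) a b c x = profile k a p q x"
    and "profile (Suc k) a b c ((2 ^ k, 0) + x) = profile k p b r x"
    and "profile (Suc k) a b c ((0, 2 ^ k) + x) = profile k q r c x"
proof -
  show "profile (Suc k) a b c x = profile k a p q x"
    using x by (simp add: p_def q_def)
  have tx: "(2 ^ k, 0) + x - (2 ^ k, 0) = x" "(0, 2 ^ k) + x - (0, 2 ^ k) = x" by simp_all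
  show "profile (Suc k) a b c ((2 ^ k, 0) + x) = profile k p b r x"
  proof (cases "(2 ^ k, 0) + x \<in> G_verts k")
    case True
    then have "x = (0, 0)"
      using G_verts_bounds[OF x] G_verts_bounds[OF True] by (simp add: level_def prod_eq_iff)
    then show ?thesis
      using profile_corners True by (simp add: p_def)
  next
    case False
    then show ?thesis
      using x unfolding profile.simps Let_def tx by (simp add: p_def r_def)
  qed
  show "profile (Suc k) a b c ((0, 2 ^ k) + x) = profile k q r c x"
  proof (cases "(0, 2 ^ k) + x \<in> G_verts k")
    case True
    then have "x = (0, 0)"
      using G_verts_bounds[OF x] G_verts_bounds[OF True] by (simp add: level_def prod_eq_iff)
    then show ?thesis
      using profile_corners True by (simp add: q_def)
  next
    case False
    show ?thesis
    proof (cases "(0, 2 ^ k) + x - (2 ^ k, 0) \<in> G_verts k")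
      case True
      then have "x = (2 ^ k, 0)"
        using G_verts_bounds[OF x] G_verts_bounds[OF True] by (simp add: level_def prod_eq_iff)
      then show ?thesis
        using profile_corners True False by (simp add: r_def)
    next
      case False': False
      then show ?thesis
        using x False unfolding profile.simps Let_def tx by (simp add: q_def r_def)
    qed
  qed
qed

lemma profile_mono:
  "a \<le> a' \<Longrightarrow> b \<le> b' \<Longrightarrow> c \<le> c' \<Longrightarrow> profile k a b c x \<le> profile k a' b' c' x"
proof (induction k arbitrary: a b c a' b' c' x)
  case (Suc k)
  then show ?case
    unfolding profile.simps Let_def
    by (auto intro!: Suc.IH simp: divide_right_mono add_mono)
qed simp

lemma profile_add_const:
  "x \<in> G_verts k \<Longrightarrow> profile k (a + d) (b + d) (c + d) x = profile k a b c x + d"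
proof (induction k arbitrary: a b c x)
  case (Suc k)
  have shift: "(2 * (a + d) + 2 * (b + d) + (c + d)) / 5 - 2 * 5 ^ k = ((2 * a + 2 * b + c) / 5 - 2 * 5 ^ k) + d"
    "(2 * (a + d) + (b + d) + 2 * (c + d)) / 5 - 2 * 5 ^ k = ((2 * a + b + 2 * c) / 5 - 2 * 5 ^ k) + d"
    "((a + d) + 2 * (b + d) + 2 * (c + d)) / 5 - 2 * 5 ^ k = ((a + 2 * b + 2 * c) / 5 - 2 * 5 ^ k) + d"
    by (simp_all add: field_simps)
  have "x \<in> G_verts k \<or> x - (2 ^ k, 0) \<in> G_verts k \<or> x - (0, 2 ^ k) \<in> G_verts k"
    using Suc.prems by (simp only: G_verts_Suc_iff)
  then show ?case
    unfolding profile.simps Let_def shift by (elim disjE) (simp_all add: Suc.IH)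
qed auto

text \<open>With corner values \<open>(2 \<cdot> 5\<^sup>k, 0, 0)\<close> the upper corners receive exactly mass \<open>1/2\<close>.  For \<open>k + 1\<close> the
  two translated pieces are again this function for \<open>k\<close>, and the remaining piece has corner values
  \<open>(10 \<cdot> 5\<^sup>k, 2 \<cdot> 5\<^sup>k, 2 \<cdot> 5\<^sup>k)\<close>, which dominate \<open>(2 \<cdot> 5\<^sup>k, 0, 0)\<close>.  Positivity cannot come from a maximum
  principle, since \<open>\<Delta>f = 1\<close> makes \<open>f\<close> subharmonic.\<close>

lemma profile_nonneg: "x \<in> G_verts k \<Longrightarrow> 0 \<le> profile k (2 * 5 ^ k) 0 0 x"
proof (induction k arbitrary: x)
  case (Suc k)
  have left: "0 \<le> profile k (2 * 5 ^ Suc k) (2 * 5 ^ k) (2 * 5 ^ k) y" if "y \<in> G_verts k" for y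
    using Suc.IH[OF that] by (rule order_trans) (rule profile_mono; simp)
  have "x \<in> G_verts k \<or> x - (2 ^ k, 0) \<in> G_verts k \<or> x - (0, 2 ^ k) \<in> G_verts k"
    using Suc.prems by (simp only: G_verts_Suc_iff)
  then show ?case
    unfolding profile.simps Let_def using left Suc.IH by (elim disjE) simp_all
qed auto

text \<open>The effective conductance of the gasket: each subdivision multiplies it by \<open>3/5\<close>.\<close>

definition conductance :: "nat \<Rightarrow> real" where
  "conductance k = (3 / 5) ^ k / 4"

text \<open>At a corner the Laplacian is the flux \<open>conductance k * (b + c - 2 * a)\<close> of the harmonic function with
  these corner values plus \<open>(1 - 3\<^sup>k) / 2\<close>; the latter is a third of the total mass \<open>- (|V| - 3)\<close> that has to
  leave through the corners to supply the \<open>|V| - 3\<close> interior points, where \<open>|V| = (3\<^sup>k\<^sup>+\<^sup>1 + 3) / 2\<close>.  The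
  coefficients below are smaller by 1 because the first summand also counts the corners.\<close>

lemma cell_lap_profile:
  "cell_lap (cells k) (profile k a b c) x =
     of_bool (x \<in> G_verts k)
     + (conductance k * (b + c - 2 * a) - (3 ^ k + 1) / 2) * of_bool (x = (0, 0))
     + (conductance k * (a + c - 2 * b) - (3 ^ k + 1) / 2) * of_bool (x = (2 ^ k, 0))
     + (conductance k * (a + b - 2 * c) - (3 ^ k + 1) / 2) * of_bool (x = (0, 2 ^ k))"
proof (induction k arbitrary: a b c x)
  case 0
  show ?case
    by (cases x) (auto simp: cell_lap_def conductance_def zero_prod_def)
next
  case (Suc k)
  define p q r where pqr: "p = (2 * a + 2 * b + c) / 5 - 2 * 5 ^ k"
    "q = (2 * a + b + 2 * c) / 5 - 2 * 5 ^ k" "r = (a + 2 * b + 2 * c) / 5 - 2 * 5 ^ k"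
  let ?K = "conductance k" and ?h = "(3 ^ k + 1) / 2 :: real"
  have K: "?K * 5 ^ k = 3 ^ k / 4" "conductance (Suc k) = 3 / 5 * ?K"
    by (simp_all add: conductance_def power_divide)
  have pieces: "cell_lap (cells (Suc k)) (profile (Suc k) a b c) x =
      cell_lap (cells k) (profile k a p q) x + cell_lap (cells k) (profile k p b r) (x - (2 ^ k, 0))
      + cell_lap (cells k) (profile k q r c) (x - (0, 2 ^ k))"
    unfolding cell_lap_Suc
    by (intro arg_cong2[of _ _ _ _ "(+)"] cell_lap_cong) (simp_all only: profile_pieces pqr)
  have corner: "?K * (p + q - 2 * a) - ?h = conductance (Suc k) * (b + c - 2 * a) - (3 ^ Suc k + 1) / 2"
    "?K * (p + r - 2 * b) - ?h = conductance (Suc k) * (a + c - 2 * b) - (3 ^ Suc k + 1) / 2"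
    "?K * (q + r - 2 * c) - ?h = conductance (Suc k) * (a + b - 2 * c) - (3 ^ Suc k + 1) / 2"
    using K(1) unfolding K(2) pqr by (simp_all add: field_simps)
  \<comment> \<open>The two one-sided Laplacians at a meeting point sum to 1: the coefficients sum to \<open>- 1\<close>, and
     both copies contribute 1 through the first summand.\<close>
  have middle: "?K * (a + q - 2 * p) - ?h + (?K * (b + r - 2 * p) - ?h) = - 1"
    "?K * (a + p - 2 * q) - ?h + (?K * (r + c - 2 * q) - ?h) = - 1"
    "?K * (p + b - 2 * r) - ?h + (?K * (q + c - 2 * r) - ?h) = - 1"
    using K(1) unfolding pqr by (simp_all add: field_simps)
  have combine: "v0 + A * i0 + B1 * i1 + C1 * i2 + (v1 + B2 * i1 + B * j1 + D1 * i3)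
      + (v2 + C2 * i2 + D2 * i3 + C * j2) = v0 + v1 + v2 - i1 - i2 - i3 + A * i0 + B * j1 + C * j2"
    if "B1 + B2 = - 1" "C1 + C2 = - 1" "D1 + D2 = - 1"
    for v0 v1 v2 A B C B1 B2 C1 C2 D1 D2 i0 i1 i2 i3 j1 j2 :: real
  proof -
    have "B1 * i1 + B2 * i1 = - i1" "C1 * i2 + C2 * i2 = - i2" "D1 * i3 + D2 * i3 = - i3"
      unfolding distrib_right[symmetric] that by simp_all
    then show ?thesis by linarith
  qed
  show ?case
    unfolding pieces Suc.IH diff_corner_iff G_verts_Suc_indicator corner by (rule combine[OF middle])
qed

section \<open>The odometer on the positive cone\<close>

text \<open>The Laplacian wanted on the positive cone for radius \<open>n\<close>: 1 below level \<open>n\<close>, and on level \<open>n\<close> mass \<open>1/2\<close>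
  for every triangle through which sand arrives.  A vertex of level \<open>n\<close> reached through two triangles
  has no neighbour on level \<open>n + 1\<close> and is filled completely; the others form the inner boundary.\<close>

definition sphere_target :: "nat \<Rightarrow> int \<Rightarrow> vertex \<Rightarrow> real" where
  "sphere_target k n x = (if level x < n then of_bool (x \<in> G_verts k)
     else if level x = n then cells_below (cells k) x / 2 else 0)"

text \<open>One half of the odometer of the ball of radius \<open>n\<close>.  The sign at the origin is part of the
  invariant because it feeds the recursion over \<open>k\<close>.\<close>

definition cone_odometer :: "nat \<Rightarrow> int \<Rightarrow> (vertex \<Rightarrow> real) \<Rightarrow> bool" where
  "cone_odometer k n w \<longleftrightarrow>
     (\<forall>x. x \<in> G_verts k \<longrightarrow> level x < n \<longrightarrow> 0 < w x) \<and>
     (\<forall>x. x \<notin> G_verts k \<or> n \<le> level x \<longrightarrow> w x = 0) \<and>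
     (\<forall>x. x \<noteq> (0, 0) \<longrightarrow> cell_lap (cells k) w x = sphere_target k n x) \<and>
     cell_lap (cells k) w (0, 0) \<le> 0"

lemma cone_odometerD:
  assumes "cone_odometer k n w"
  shows "x \<in> G_verts k \<Longrightarrow> level x < n \<Longrightarrow> 0 < w x"
    and "x \<notin> G_verts k \<or> n \<le> level x \<Longrightarrow> w x = 0"
    and "x \<noteq> (0, 0) \<Longrightarrow> cell_lap (cells k) w x = sphere_target k n x"
    and "cell_lap (cells k) w (0, 0) \<le> 0"
  using assms unfolding cone_odometer_def by blast+

lemma cells_below_eq_0: "level x \<le> 0 \<or> 2 ^ k < level x \<Longrightarrow> cells_below (cells k) x = 0"
  using cells_bounds[of "x - (1, 0)" k] cells_bounds[of "x - (0, 1)" k]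
  by (auto simp: cells_below_def level_def)

lemma cell_lap_zero: "cell_lap S (\<lambda>_. 0) x = 0"
  by (simp add: cell_lap_def)

lemma cone_odometer_base: "cone_odometer 0 1 (profile 0 2 0 0)"
proof -
  have "cell_lap (cells 0) (profile 0 2 0 0) x = sphere_target 0 1 x" if "x \<noteq> (0, 0)" for x
    using that by (cases x) (auto simp: cell_lap_def sphere_target_def cells_below_def level_def zero_prod_def)
  moreover have "cell_lap (cells 0) (profile 0 2 0 0) (0, 0) \<le> 0"
    by (simp add: cell_lap_def zero_prod_def)
  ultimately show ?thesis
    by (auto simp: cone_odometer_def level_def)
qed

text \<open>Everything happens inside \<open>G\<^sub>k\<close>: the function vanishes on the two translated copies.\<close>

lemma cone_odometer_extend:
  assumes w: "cone_odometer k n w" and n: "n \<le> 2 ^ k"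
  shows "cone_odometer (Suc k) n w"
proof -
  have shift: "level x < 2 ^ k \<Longrightarrow> x - (2 ^ k, 0) \<notin> G_verts k \<and> x - (0, 2 ^ k) \<notin> G_verts k" for x
    using G_verts_bounds[of "x - (2 ^ k, 0)" k] G_verts_bounds[of "x - (0, 2 ^ k)" k]
    by (auto simp: level_def)
  have verts: "x \<in> G_verts (Suc k) \<longleftrightarrow> x \<in> G_verts k" if "level x < 2 ^ k" for x
    using shift[OF that] by (simp add: G_verts_Suc_iff del: G_verts.simps)
  have target: "sphere_target (Suc k) n x = sphere_target k n x" for x
    using n verts[of x] cells_below_eq_0[of "x - (2 ^ k, 0)" k] cells_below_eq_0[of "x - (0, 2 ^ k)" k]
    unfolding sphere_target_def cells_below_Suc by (auto simp: level_def)
  have "w ((2 ^ k, 0) + y) = 0" "w ((0, 2 ^ k) + y) = 0" if "y \<in> G_verts k" for y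
    using n G_verts_bounds[OF that] by (auto intro!: cone_odometerD(2)[OF w] simp: level_def)
  then have "cell_lap (cells k) (\<lambda>y. w ((2 ^ k, 0) + y)) x = cell_lap (cells k) (\<lambda>_. 0) x"
    "cell_lap (cells k) (\<lambda>y. w ((0, 2 ^ k) + y)) x = cell_lap (cells k) (\<lambda>_. 0) x" for x
    by (intro cell_lap_cong; simp)+
  then have "cell_lap (cells (Suc k)) w x = cell_lap (cells k) w x" for x
    unfolding cell_lap_Suc by (simp add: cell_lap_zero)
  moreover have "0 < w x" if "x \<in> G_verts (Suc k)" "level x < n" for x
    using that n verts[of x] cone_odometerD(1)[OF w, of x] by simp
  moreover have "w x = 0" if "x \<notin> G_verts (Suc k) \<or> n \<le> level x" for x
    using that by (intro cone_odometerD(2)[OF w]) (simp only: G_verts_Suc_iff, blast)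
  ultimately show ?thesis
    using cone_odometerD(3,4)[OF w] target unfolding cone_odometer_def by simp
qed

text \<open>For radius \<open>2\<^sup>k + j\<close> the part of the cone above level \<open>2\<^sup>k\<close> consists of two translates of the cone of radius
  \<open>j\<close>, attached to \<open>G\<^sub>k\<close> at the corners \<open>(2\<^sup>k, 0)\<close> and \<open>(0, 2\<^sup>k)\<close>.  Use the function \<open>w\<close> for radius \<open>j\<close> on both and
  a profile on \<open>G\<^sub>k\<close>.  Continuity forces the profile to be \<open>c = w (0, 0)\<close> at both corners, and its remaining
  parameter, the value \<open>\<alpha>\<close> at the origin, is chosen so that the Laplacian at the corners is 1.  By
  symmetry one parameter serves both corners.  Since \<open>w\<close> has \<open>\<Delta>w \<le> 0\<close> at its origin, \<open>\<alpha> - c\<close> is at least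
  \<open>2 \<cdot> 5\<^sup>k\<close>, which makes the profile positive.\<close>

lemma cone_odometer_step:
  assumes w: "cone_odometer k j w" and j: "1 \<le> j" "j \<le> 2 ^ k"
  shows "\<exists>w'. cone_odometer (Suc k) (2 ^ k + j) w'"
proof -
  define n where "n = 2 ^ k + j"
  define c where "c = w (0, 0)"
  define g where "g = cell_lap (cells k) w (0, 0)"
  define K where "K = conductance k"
  define \<alpha> where "\<alpha> = c + ((3 ^ k + 1) / 2 - g) / K"
  define P where "P = profile k \<alpha> c c"
  define w' where "w' = (\<lambda>x. if x \<in> G_verts k then P x else w (x - (2 ^ k, 0)) + w (x - (0, 2 ^ k)))"
  note w_pos = cone_odometerD(1)[OF w] and w_zero = cone_odometerD(2)[OF w]
    and lap_w = cone_odometerD(3)[OF w]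
  have g: "g \<le> 0" using cone_odometerD(4)[OF w] by (simp add: g_def)
  have w_nonneg: "0 \<le> w x" for x
    using w_pos[of x] w_zero[of x] by fastforce
  have "c > 0"
    unfolding c_def using w_pos zero_in_G_verts j by (simp add: level_def)
  have "K > 0" by (simp add: K_def conductance_def)
  have K\<alpha>: "K * (\<alpha> - c) = (3 ^ k + 1) / 2 - g"
    using \<open>K > 0\<close> by (simp add: \<alpha>_def)
  have "K * (2 * 5 ^ k) = 3 ^ k / 2"
    by (simp add: K_def conductance_def power_divide)
  then have "K * (2 * 5 ^ k) \<le> K * (\<alpha> - c)"
    unfolding K\<alpha> using g by (simp add: field_simps)
  then have \<alpha>: "2 * 5 ^ k + c \<le> \<alpha>"
    using \<open>K > 0\<close> by simp
  have P_pos: "0 < P x" if "x \<in> G_verts k" for x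
  proof -
    have "0 < profile k (2 * 5 ^ k) 0 0 x + c"
      using profile_nonneg[OF that] \<open>c > 0\<close> by simp
    also have "\<dots> = profile k (2 * 5 ^ k + c) (0 + c) (0 + c) x"
      by (rule profile_add_const[OF that, symmetric])
    also have "\<dots> \<le> P x"
      unfolding P_def using \<alpha> by (intro profile_mono) simp_all
    finally show ?thesis .
  qed
  have origin: "y = (0, 0)" if "y \<in> G_verts k" "t + y \<in> G_verts k" "level t = 2 ^ k" for t y
    using G_verts_bounds[OF that(1)] G_verts_bounds[OF that(2)] that(3)
    by (auto simp: level_def prod_eq_iff)
  \<comment> \<open>The two translates can meet only in \<open>(2\<^sup>k, 2\<^sup>k)\<close>, where both copies of \<open>w\<close> vanish because \<open>j \<le> 2\<^sup>k\<close>.\<close>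
  have w_far: "w (t + y - t') = 0" if "y \<in> G_verts k" "t + y \<notin> G_verts k"
    and t: "t = (2 ^ k, 0) \<and> t' = (0, 2 ^ k) \<or> t = (0, 2 ^ k) \<and> t' = (2 ^ k, 0)" for t t' y
  proof (rule ccontr)
    assume "w (t + y - t') \<noteq> 0"
    then have "t + y - t' \<in> G_verts k" "level (t + y - t') < j"
      using w_zero by (blast, meson linorder_not_less)
    then show False
      using t G_verts_bounds[OF that(1)] G_verts_bounds[of "t + y - t'" k] j by (auto simp: level_def)
  qed
  have w'_left: "w' y = P y" if "y \<in> G_verts k" for y
    using that by (simp add: w'_def)
  have w'_right: "w' ((2 ^ k, 0) + y) = w y" if "y \<in> G_verts k" for y
  proof (cases "(2 ^ k, 0) + y \<in> G_verts k")
    case True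
    with origin[OF that True] have "y = (0, 0)" by (simp add: level_def)
    then show ?thesis using True by (simp add: w'_def P_def profile_corners c_def)
  next
    case False
    then show ?thesis
      using w_far[OF that False, of "(0, 2 ^ k)"] by (simp add: w'_def)
  qed
  have w'_top: "w' ((0, 2 ^ k) + y) = w y" if "y \<in> G_verts k" for y
  proof (cases "(0, 2 ^ k) + y \<in> G_verts k")
    case True
    with origin[OF that True] have "y = (0, 0)" by (simp add: level_def)
    then show ?thesis using True by (simp add: w'_def P_def profile_corners c_def)
  next
    case False
    then show ?thesis
      using w_far[OF that False, of "(2 ^ k, 0)"] by (simp add: w'_def)
  qed
  have lap_w': "cell_lap (cells (Suc k)) w' x =
      cell_lap (cells k) P x + cell_lap (cells k) w (x - (2 ^ k, 0)) + cell_lap (cells k) w (x - (0, 2 ^ k))" for x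
    unfolding cell_lap_Suc
    by (intro arg_cong2[of _ _ _ _ "(+)"] cell_lap_cong) (simp_all only: w'_left w'_right w'_top)
  have lap_P: "cell_lap (cells k) P x = of_bool (x \<in> G_verts k)
      + (K * (c + c - 2 * \<alpha>) - (3 ^ k + 1) / 2) * of_bool (x = (0, 0))
      - g * of_bool (x = (2 ^ k, 0)) - g * of_bool (x = (0, 2 ^ k))" for x
  proof -
    have "K * (\<alpha> + c - 2 * c) - (3 ^ k + 1) / 2 = - g"
    proof -
      have "\<alpha> + c - 2 * c = \<alpha> - c" by simp
      then show ?thesis using K\<alpha> by simp
    qed
    then show ?thesis
      unfolding P_def cell_lap_profile K_def[symmetric] by simp
  qed
  have target_0: "sphere_target k j (0, 0) = 1"
    using j zero_in_G_verts by (simp add: sphere_target_def level_def)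
  have lap_w_all: "cell_lap (cells k) w y = sphere_target k j y + (g - 1) * of_bool (y = (0, 0))" for y
    using lap_w[of y] target_0 by (auto simp: g_def)
  have "cell_lap (cells (Suc k)) w' x = sphere_target (Suc k) n x" if "x \<noteq> (0, 0)" for x
  proof -
    \<comment> \<open>The defect \<open>g\<close> of \<open>w\<close> at its origin cancels against the flux of the profile into the corner.\<close>
    have "cell_lap (cells (Suc k)) w' x = of_bool (x \<in> G_verts k)
        + sphere_target k j (x - (2 ^ k, 0)) + sphere_target k j (x - (0, 2 ^ k))
        - of_bool (x = (2 ^ k, 0)) - of_bool (x = (0, 2 ^ k))"
      unfolding lap_w' lap_P lap_w_all diff_corner_iff using that by (simp add: left_diff_distrib)
    also have "\<dots> = sphere_target (Suc k) n x"
    proof -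
      have lev: "level (x - (2 ^ k, 0)) = level x - 2 ^ k" "level (x - (0, 2 ^ k)) = level x - 2 ^ k"
        by (simp_all add: level_def)
      consider "level x < n" | "level x = n" | "n < level x" by linarith
      then show ?thesis
      proof cases
        case 1
        then have "x \<noteq> (2 ^ k, 2 ^ k)" using j by (auto simp: n_def level_def)
        with 1 show ?thesis
          unfolding sphere_target_def lev G_verts_Suc_indicator by (simp add: n_def)
      next
        case 2
        then have "x \<notin> G_verts k" "x \<noteq> (2 ^ k, 0)" "x \<noteq> (0, 2 ^ k)"
          using j G_verts_bounds[of x k] by (auto simp: n_def level_def)
        moreover have "cells_below (cells k) x = 0"
          using 2 j by (intro cells_below_eq_0) (simp add: n_def)
        ultimately show ?thesis
          using 2 unfolding sphere_target_def lev cells_below_Suc by (simp add: n_def)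
      next
        case 3
        then have "x \<notin> G_verts k" "x \<noteq> (2 ^ k, 0)" "x \<noteq> (0, 2 ^ k)"
          using j G_verts_bounds[of x k] by (auto simp: n_def level_def)
        then show ?thesis
          using 3 unfolding sphere_target_def lev by (simp add: n_def)
      qed
    qed
    finally show ?thesis .
  qed
  moreover have "cell_lap (cells (Suc k)) w' (0, 0) \<le> 0"
  proof -
    have "sphere_target k j (- (2 ^ k), 0) = 0" "sphere_target k j (0, - (2 ^ k)) = 0"
      using j G_verts_bounds[of "(- (2 ^ k), 0)" k] G_verts_bounds[of "(0, - (2 ^ k))" k]
      by (auto simp: sphere_target_def level_def)
    then have "cell_lap (cells (Suc k)) w' (0, 0) = 1 + (K * (c + c - 2 * \<alpha>) - (3 ^ k + 1) / 2)"
      unfolding lap_w' lap_P lap_w_all by (simp add: zero_in_G_verts zero_prod_def)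
    also have "K * (c + c - 2 * \<alpha>) = 2 * g - (3 ^ k + 1)"
    proof -
      have "K * (c + c - 2 * \<alpha>) = - 2 * (K * (\<alpha> - c))" by (simp add: algebra_simps)
      then show ?thesis unfolding K\<alpha> by (simp add: field_simps)
    qed
    finally have "cell_lap (cells (Suc k)) w' (0, 0) = 1 + (2 * g - (3 ^ k + 1) - (3 ^ k + 1) / 2)" .
    also have "\<dots> \<le> 0"
    proof -
      have "1 + (2 * g - (z + 1) - (z + 1) / 2) \<le> 0" if "1 \<le> z" for z
        using that g by (simp add: field_simps)
      then show ?thesis by simp
    qed
    finally show ?thesis .
  qed
  moreover have "0 < w' x" if x: "x \<in> G_verts (Suc k)" and "level x < n" for x
  proof -
    consider "x \<in> G_verts k" | "x \<notin> G_verts k" "x - (2 ^ k, 0) \<in> G_verts k"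
      | "x \<notin> G_verts k" "x - (0, 2 ^ k) \<in> G_verts k"
      using x unfolding G_verts_Suc_iff by blast
    then show ?thesis
    proof cases
      case 2
      have "0 < w (x - (2 ^ k, 0))"
        using \<open>level x < n\<close> by (intro w_pos[OF 2(2)]) (simp add: n_def level_def)
      then show ?thesis using 2 w_nonneg[of "x - (0, 2 ^ k)"] by (simp add: w'_def)
    next
      case 3
      have "0 < w (x - (0, 2 ^ k))"
        using \<open>level x < n\<close> by (intro w_pos[OF 3(2)]) (simp add: n_def level_def)
      then show ?thesis using 3 w_nonneg[of "x - (2 ^ k, 0)"] by (simp add: w'_def)
    qed (simp add: w'_def P_pos)
  qed
  moreover have "w' x = 0" if "x \<notin> G_verts (Suc k) \<or> n \<le> level x" for x
  proof -
    have "x \<notin> G_verts k"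
      using that j G_verts_bounds[of x k] unfolding G_verts_Suc_iff n_def by auto
    moreover have "w (x - t) = 0" if "t = (2 ^ k, 0) \<or> t = (0, 2 ^ k)" for t
    proof (rule w_zero)
      show "x - t \<notin> G_verts k \<or> j \<le> level (x - t)"
        using that \<open>x \<notin> G_verts (Suc k) \<or> n \<le> level x\<close> unfolding G_verts_Suc_iff
        by (auto simp: n_def level_def)
    qed
    ultimately show ?thesis by (simp add: w'_def)
  qed
  ultimately have "cone_odometer (Suc k) n w'"
    by (simp add: cone_odometer_def del: G_verts.simps cells.simps)
  then show ?thesis unfolding n_def by blast
qed

lemma cone_odometer_exists:
  "1 \<le> n \<Longrightarrow> n \<le> 2 ^ k \<Longrightarrow> \<exists>w. cone_odometer k n w"
proof (induction k arbitrary: n)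
  case 0
  then have "n = 1" by simp
  then show ?case using cone_odometer_base by blast
next
  case (Suc k)
  show ?case
  proof (cases "n \<le> 2 ^ k")
    case True
    then show ?thesis using Suc cone_odometer_extend by blast
  next
    case False
    then have j: "1 \<le> n - 2 ^ k" "n - 2 ^ k \<le> 2 ^ k" using Suc.prems by auto
    then show ?thesis using Suc.IH cone_odometer_step[OF _ j] by fastforce
  qed
qed

section \<open>Adjacency in terms of triangles\<close>

definition all_cells :: "vertex set" where
  "all_cells = (\<Union>k. cells k)"

lemma G_edges_iff:
  "{x, y} \<in> G_edges k \<longleftrightarrow> x \<noteq> y \<and> (\<exists>a\<in>cells k. x \<in> cell a \<and> y \<in> cell a)"
proof (induction k arbitrary: x y)
  case 0
  show ?case by (auto simp: cell_def card_insert_if)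
next
  case (Suc k)
  have image: "{x, y} \<in> (\<lambda>e. (+) t ` e) ` A \<longleftrightarrow> {x - t, y - t} \<in> A" for t and A :: "vertex set set"
  proof
    assume "{x, y} \<in> (\<lambda>e. (+) t ` e) ` A"
    then obtain e where e: "e \<in> A" "{x, y} = (+) t ` e" by blast
    have "e = (\<lambda>v. v - t) ` (+) t ` e" by (simp add: image_image)
    also have "\<dots> = {x - t, y - t}" unfolding e(2)[symmetric] by simp
    finally show "{x - t, y - t} \<in> A" using e(1) by simp
  next
    assume "{x - t, y - t} \<in> A"
    moreover have "{x, y} = (+) t ` {x - t, y - t}" by simp
    ultimately show "{x, y} \<in> (\<lambda>e. (+) t ` e) ` A" by blast
  qed
  have cell: "z - t \<in> cell a \<longleftrightarrow> z \<in> cell (t + a)" for z t a :: vertex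
    by (auto simp: cell_def prod_eq_iff)
  have "{x, y} \<in> G_edges (Suc k) \<longleftrightarrow> (\<exists>t\<in>shifts k. {x - t, y - t} \<in> G_edges k)"
    using image by simp
  also have "\<dots> \<longleftrightarrow> (\<exists>t\<in>shifts k. \<exists>a\<in>cells k. x \<noteq> y \<and> x \<in> cell (t + a) \<and> y \<in> cell (t + a))"
    unfolding Suc.IH cell by auto
  also have "\<dots> \<longleftrightarrow> x \<noteq> y \<and> (\<exists>a\<in>cells (Suc k). x \<in> cell a \<and> y \<in> cell a)"
    by auto
  finally show ?case .
qed

text \<open>The neighbours in the positive half \<open>SG\<^sup>+\<close>.\<close>

definition cell_nbrs :: "vertex \<Rightarrow> vertex set" where
  "cell_nbrs x = {y. x \<noteq> y \<and> (\<exists>a\<in>all_cells. x \<in> cell a \<and> y \<in> cell a)}"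

lemma adj_iff_cell_nbrs: "adj x y \<longleftrightarrow> y \<in> cell_nbrs x \<or> - y \<in> cell_nbrs (- x)"
proof -
  have pos: "{x, y} \<in> SG_pos_edges \<longleftrightarrow> y \<in> cell_nbrs x" for x y
    by (auto simp: SG_pos_edges_def G_edges_iff cell_nbrs_def all_cells_def)
  have "{x, y} \<in> (\<lambda>e. uminus ` e) ` SG_pos_edges \<longleftrightarrow> {- x, - y} \<in> SG_pos_edges"
  proof
    assume "{x, y} \<in> (\<lambda>e. uminus ` e) ` SG_pos_edges"
    then obtain e where e: "e \<in> SG_pos_edges" "{x, y} = uminus ` e" by blast
    have "e = uminus ` uminus ` e" by (simp add: image_image)
    also have "\<dots> = {- x, - y}" unfolding e(2)[symmetric] by simp
    finally show "{- x, - y} \<in> SG_pos_edges" using e(1) by simp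
  next
    assume "{- x, - y} \<in> SG_pos_edges"
    moreover have "{x, y} = uminus ` {- x, - y}" by simp
    ultimately show "{x, y} \<in> (\<lambda>e. uminus ` e) ` SG_pos_edges" by blast
  qed
  then show ?thesis
    unfolding adj_def SG_edges_def using pos by blast
qed

lemma adj_uminus [simp]: "adj (- x) (- y) \<longleftrightarrow> adj x y"
  by (auto simp: adj_iff_cell_nbrs)

lemma not_adj_self: "\<not> adj x x"
  by (simp add: adj_iff_cell_nbrs cell_nbrs_def)

text \<open>The six possible neighbours \<open>x \<plusminus> (1, 0)\<close>, \<open>x \<plusminus> (0, 1)\<close>, \<open>x \<plusminus> (1, -1)\<close> are distinct, and each occurs in just one
  of the three triangles that may contain \<open>x\<close>.\<close>

lemma sum_cell_nbrs:
  fixes f :: "vertex \<Rightarrow> real"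
  shows "finite (cell_nbrs x)"
    and "(\<Sum>y\<in>cell_nbrs x. f y) =
      of_bool (x \<in> all_cells) * (f (x + (1, 0)) + f (x + (0, 1)))
    + of_bool (x - (1, 0) \<in> all_cells) * (f (x - (1, 0)) + f (x - (1, 0) + (0, 1)))
    + of_bool (x - (0, 1) \<in> all_cells) * (f (x - (0, 1)) + f (x - (0, 1) + (1, 0)))"
proof -
  define A where "A = (if x \<in> all_cells then {x + (1, 0), x + (0, 1)} else {})"
  define B where "B = (if x - (1, 0) \<in> all_cells then {x - (1, 0), x - (1, 0) + (0, 1)} else {})"
  define C where "C = (if x - (0, 1) \<in> all_cells then {x - (0, 1), x - (0, 1) + (1, 0)} else {})"
  have "y \<in> cell_nbrs x \<longleftrightarrow> y \<in> A \<union> B \<union> C" for y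
  proof -
    have "x \<in> cell a \<longleftrightarrow> a = x \<or> a = x - (1, 0) \<or> a = x - (0, 1)" for a
      by (auto simp: cell_def prod_eq_iff)
    then have "y \<in> cell_nbrs x \<longleftrightarrow> x \<noteq> y \<and> (x \<in> all_cells \<and> y \<in> cell x \<or>
        x - (1, 0) \<in> all_cells \<and> y \<in> cell (x - (1, 0)) \<or> x - (0, 1) \<in> all_cells \<and> y \<in> cell (x - (0, 1)))"
      unfolding cell_nbrs_def by auto
    also have "\<dots> \<longleftrightarrow> y \<in> A \<union> B \<union> C"
      by (auto simp: A_def B_def C_def cell_def prod_eq_iff)
    finally show ?thesis .
  qed
  then have eq: "cell_nbrs x = A \<union> B \<union> C" by blast
  have fin: "finite A" "finite B" "finite C" by (simp_all add: A_def B_def C_def)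
  then show "finite (cell_nbrs x)" by (simp add: eq)
  have "A \<inter> B = {}" "(A \<union> B) \<inter> C = {}"
    by (auto simp: A_def B_def C_def prod_eq_iff)
  then have "sum f (cell_nbrs x) = sum f A + sum f B + sum f C"
    unfolding eq using fin by (simp add: sum.union_disjoint)
  also have "sum f A = of_bool (x \<in> all_cells) * (f (x + (1, 0)) + f (x + (0, 1)))"
    by (simp add: A_def prod_eq_iff)
  also have "sum f B = of_bool (x - (1, 0) \<in> all_cells) * (f (x - (1, 0)) + f (x - (1, 0) + (0, 1)))"
    by (simp add: B_def prod_eq_iff)
  also have "sum f C = of_bool (x - (0, 1) \<in> all_cells) * (f (x - (0, 1)) + f (x - (0, 1) + (1, 0)))"
    by (simp add: C_def prod_eq_iff)
  finally show "(\<Sum>y\<in>cell_nbrs x. f y) =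
      of_bool (x \<in> all_cells) * (f (x + (1, 0)) + f (x + (0, 1)))
    + of_bool (x - (1, 0) \<in> all_cells) * (f (x - (1, 0)) + f (x - (1, 0) + (0, 1)))
    + of_bool (x - (0, 1) \<in> all_cells) * (f (x - (0, 1)) + f (x - (0, 1) + (1, 0)))" .
qed

text \<open>Copies added at later stages start at level \<open>2\<^sup>k\<close> or above.\<close>

lemma all_cells_truncate:
  assumes "level x < 2 ^ k"
  shows "x \<in> all_cells \<longleftrightarrow> x \<in> cells k"
proof -
  have "x \<in> cells (k + j) \<longleftrightarrow> x \<in> cells k" for j
  proof (induction j)
    case (Suc j)
    have "level x < 2 ^ (k + j)"
      using assms by (rule less_le_trans) (simp add: power_increasing)
    then have "x - (2 ^ (k + j), 0) \<notin> cells (k + j)" "x - (0, 2 ^ (k + j)) \<notin> cells (k + j)"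
      using cells_bounds[of "x - (2 ^ (k + j), 0)" "k + j"] cells_bounds[of "x - (0, 2 ^ (k + j))" "k + j"]
      by (auto simp: level_def)
    then show ?case using Suc by (simp add: cells_Suc_iff del: cells.simps)
  qed simp
  moreover have "x \<in> cells j \<Longrightarrow> x \<in> cells (j + k)" for j
    by (induction k) (simp_all add: cells_Suc_iff del: cells.simps)
  ultimately show ?thesis
    unfolding all_cells_def by (metis UN_E UN_I UNIV_I add.commute)
qed

lemma cells_below_truncate:
  assumes "level x < 2 ^ k"
  shows "cells_below all_cells x = cells_below (cells k) x"
proof -
  have "level (x - (1, 0)) < 2 ^ k" "level (x - (0, 1)) < 2 ^ k"
    using assms by (simp_all add: level_def)
  then show ?thesis
    by (simp add: cells_below_def all_cells_truncate)
qed

lemma SG_pos_truncate: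
  assumes "level x < 2 ^ k"
  shows "x \<in> SG_pos \<longleftrightarrow> x \<in> G_verts k"
proof -
  have "x \<in> G_verts (k + j) \<longleftrightarrow> x \<in> G_verts k" for j
  proof (induction j)
    case (Suc j)
    have "level x < 2 ^ (k + j)"
      using assms by (rule less_le_trans) (simp add: power_increasing)
    then have "x - (2 ^ (k + j), 0) \<notin> G_verts (k + j)" "x - (0, 2 ^ (k + j)) \<notin> G_verts (k + j)"
      using G_verts_bounds[of "x - (2 ^ (k + j), 0)" "k + j"] G_verts_bounds[of "x - (0, 2 ^ (k + j))" "k + j"]
      by (auto simp: level_def)
    then show ?case using Suc by (simp add: G_verts_Suc_iff del: G_verts.simps)
  qed simp
  moreover have "x \<in> G_verts j \<Longrightarrow> x \<in> G_verts (j + k)" for j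
    by (induction k) (simp_all add: G_verts_Suc_iff del: G_verts.simps)
  ultimately show ?thesis
    unfolding SG_pos_def by (metis UN_E UN_I UNIV_I add.commute)
qed

lemma int_less_power_of_two: "\<exists>k. n < (2::int) ^ k"
proof -
  have "n \<le> int (nat n)" by simp
  also have "\<dots> < 2 ^ nat n" by (rule of_nat_less_two_power)
  finally show ?thesis by blast
qed

lemma SG_pos_nonneg: "x \<in> SG_pos \<Longrightarrow> 0 \<le> fst x \<and> 0 \<le> snd x \<and> taxi x = level x"
  unfolding SG_pos_def using G_verts_bounds by (fastforce simp: taxi_def level_def)

text \<open>At a stage \<open>k\<close> with \<open>level x < 2\<^sup>k\<close>, the vertex \<open>x\<close> is not a corner.\<close>

lemma SG_pos_two_cells:
  assumes "x \<in> SG_pos" "x \<noteq> (0, 0)"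
  shows "of_bool (x \<in> all_cells) + cells_below all_cells x = 2"
proof -
  obtain k where k: "level x < 2 ^ k" using int_less_power_of_two by blast
  then have "of_bool (x \<in> all_cells) + cells_below all_cells x = of_bool (x \<in> cells k) + cells_below (cells k) x"
    by (simp add: all_cells_truncate cells_below_truncate)
  also have "x \<noteq> (2 ^ k, 0)" "x \<noteq> (0, 2 ^ k)" using k by (auto simp: level_def)
  then have "of_bool (x \<in> cells k) + cells_below (cells k) x = 2"
    unfolding number_of_cells using assms SG_pos_truncate[OF k] by simp
  finally show ?thesis .
qed

lemma cell_nbrs_subset:
  assumes "y \<in> cell_nbrs x"
  shows "x \<in> SG_pos" "y \<in> SG_pos"
  using assms cell_subset_G_verts unfolding cell_nbrs_def all_cells_def SG_pos_def by blast+

lemma SG_pos_inter_uminus: "x \<in> SG_pos \<Longrightarrow> - x \<in> SG_pos \<Longrightarrow> x = (0, 0)"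
  using SG_pos_nonneg[of x] SG_pos_nonneg[of "- x"] by (simp add: prod_eq_iff)

lemma nbrs_SG_pos:
  assumes "x \<in> SG_pos" "x \<noteq> (0, 0)"
  shows "{y. adj x y} = cell_nbrs x"
  using assms SG_pos_inter_uminus cell_nbrs_subset(1) unfolding adj_iff_cell_nbrs by blast

lemma nbrs_origin: "{y. adj (0, 0) y} = {(1, 0), (0, 1), (-1, 0), (0, -1)}"
proof -
  have "(0, 0) \<in> all_cells" "(- 1, 0) \<notin> all_cells" "(0, - 1) \<notin> all_cells"
    using zero_in_cells cells_bounds unfolding all_cells_def by force+
  moreover have "(0, 0) \<in> cell a \<longleftrightarrow> a \<in> {(0, 0), (- 1, 0), (0, - 1)}" for a
    by (cases a) (auto simp: cell_def)
  ultimately have "cell_nbrs (0, 0) = cell (0, 0) - {(0, 0)}"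
    unfolding cell_nbrs_def by auto
  then have "y \<in> cell_nbrs (0, 0) \<longleftrightarrow> y = (1, 0) \<or> y = (0, 1)" for y
    by (auto simp: cell_def)
  then have "adj (0, 0) y \<longleftrightarrow> y = (1, 0) \<or> y = (0, 1) \<or> - y = (1, 0) \<or> - y = (0, 1)" for y
    by (simp add: adj_iff_cell_nbrs)
  then show ?thesis
    by (auto simp: prod_eq_iff)
qed

text \<open>Since \<open>x \<mapsto> - x\<close> is an automorphism of the graph, the third case reduces to the second.\<close>

lemma SG_cases:
  assumes "x \<in> SG"
  obtains "x = (0, 0)" | "x \<in> SG_pos" "x \<noteq> (0, 0)" | "- x \<in> SG_pos" "- x \<noteq> (0, 0)"
  using assms by (cases "x = (0, 0)") (auto simp: SG_def zero_prod_def)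

lemma nbrs_uminus: "{y. adj (- x) y} = uminus ` {y. adj x y}"
proof -
  have "adj (- x) y \<longleftrightarrow> adj x (- y)" for y
    using adj_uminus[of x "- y"] by simp
  then show ?thesis
    by (auto simp: image_iff) (metis minus_minus)
qed

lemma SG_regular:
  assumes "x \<in> SG"
  shows "card {y. adj x y} = 4"
proof -
  have pos: "card {y. adj x y} = 4" if "x \<in> SG_pos" "x \<noteq> (0, 0)" for x
  proof -
    have "real (card {y. adj x y}) = (\<Sum>y\<in>cell_nbrs x. 1)"
      using that by (simp add: nbrs_SG_pos)
    also have "\<dots> = 2 * (of_bool (x \<in> all_cells) + cells_below all_cells x)"
      unfolding sum_cell_nbrs(2) cells_below_def by simp
    also have "\<dots> = 4"
      using SG_pos_two_cells[OF that] by simp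
    finally show ?thesis by simp
  qed
  show ?thesis
    using assms
  proof (cases rule: SG_cases)
    case 3
    have "card {y. adj (- (- x)) y} = card {y. adj (- x) y}"
      unfolding nbrs_uminus[of "- x"] by (rule card_image) simp
    with pos[OF 3] show ?thesis by simp
  qed (use pos in \<open>simp_all add: nbrs_origin\<close>)
qed

lemma finite_nbrs: "finite {y. adj x y}"
proof (cases "{y. adj x y} = {}")
  case True
  then show ?thesis by (simp only: finite.emptyI)
next
  case False
  then have "card {y. adj x y} = 4" using adj_step SG_regular by blast
  then show ?thesis by (intro card_ge_0_finite) simp
qed

lemma Laplacian_uminus:
  assumes "\<And>y. u (- y) = u y"
  shows "Laplacian u (- x) = Laplacian u x"
  using assms unfolding Laplacian_def nbrs_uminus by (simp add: sum.reindex)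

lemma Laplacian_SG_pos:
  assumes "x \<in> SG_pos" "x \<noteq> (0, 0)"
  shows "Laplacian f x = cell_lap all_cells f x"
proof -
  have quarter: "4 * (z / 4) = z" for z :: real by simp
  have balance: "i * s + j * t + k * r - 2 * (i + (j + k)) * z =
      i * (s - 2 * z) + j * (t - 2 * z) + k * (r - 2 * z)" for i j k r s t z :: real
    by (simp add: algebra_simps)
  have "4 * Laplacian f x = (\<Sum>y\<in>cell_nbrs x. f y) - 2 * 2 * f x"
    using assms by (simp add: Laplacian_def nbrs_SG_pos)
  also have "\<dots> = (\<Sum>y\<in>cell_nbrs x. f y) - 2 * (of_bool (x \<in> all_cells) + cells_below all_cells x) * f x"
    using SG_pos_two_cells[OF assms] by simp
  also have "\<dots> = 4 * cell_lap all_cells f x"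
    unfolding sum_cell_nbrs(2) cell_lap_def cells_below_def quarter
    by (rule balance)
  finally show ?thesis by simp
qed

section \<open>The odometer of a ball\<close>

lemma finite_SG_ball: "finite (SG_ball n)"
proof (rule finite_subset)
  show "SG_ball n \<subseteq> {- n..n} \<times> {- n..n}" by (auto simp: SG_ball_def)
qed simp

lemma inner_boundary_subset: "inner_boundary n \<subseteq> SG_ball n"
  by (auto simp: inner_boundary_def)

lemma uminus_in_SG [simp]: "- x \<in> SG \<longleftrightarrow> x \<in> SG"
  unfolding SG_def by (auto simp: image_iff) (metis minus_minus)+

lemma uminus_in_SG_ball [simp]: "- x \<in> SG_ball n \<longleftrightarrow> x \<in> SG_ball n"
  by (simp add: SG_ball_taxi)

lemma uminus_in_inner_boundary [simp]: "- x \<in> inner_boundary n \<longleftrightarrow> x \<in> inner_boundary n"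
proof -
  have *: "- x \<in> inner_boundary n" if x: "x \<in> inner_boundary n" for x
  proof -
    obtain v where "v \<in> SG - SG_ball n" "adj x v" using x by (auto simp: inner_boundary_def)
    then have "- v \<in> SG - SG_ball n" "adj (- x) (- v)" by auto
    moreover have "- x \<in> SG_ball n" using x by (simp add: inner_boundary_def)
    ultimately show ?thesis unfolding inner_boundary_def by blast
  qed
  show ?thesis using *[of x] *[of "- x"] by auto
qed

lemma inner_boundary_taxi: "x \<in> inner_boundary n \<Longrightarrow> taxi x = n"
proof -
  assume "x \<in> inner_boundary n"
  then obtain v where "taxi x \<le> n" "v \<in> SG" "\<not> taxi v \<le> n" "adj x v"
    by (auto simp: inner_boundary_def SG_ball_taxi)
  then show "taxi x = n" using adj_step[of x v] by linarith
qed

text \<open>A neighbour on the next level exists iff \<open>x\<close> is the lower corner of a triangle.\<close>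

lemma inner_boundary_iff:
  assumes x: "x \<in> SG_pos" "x \<noteq> (0, 0)" and n: "level x = n"
  shows "x \<in> inner_boundary n \<longleftrightarrow> x \<in> all_cells"
proof
  assume "x \<in> inner_boundary n"
  then obtain v where v: "v \<in> SG" "v \<notin> SG_ball n" "adj x v"
    by (auto simp: inner_boundary_def)
  then have "v \<in> cell_nbrs x" using nbrs_SG_pos[OF x] by blast
  then have "v \<in> SG_pos" and "\<exists>a\<in>all_cells. x \<in> cell a \<and> v \<in> cell a"
    using cell_nbrs_subset(2) by (auto simp: cell_nbrs_def)
  then obtain a where a: "a \<in> all_cells" "x \<in> cell a" "v \<in> cell a" by blast
  have "level v > level x"
    using v \<open>v \<in> SG_pos\<close> SG_pos_nonneg[of v] n by (simp add: SG_ball_taxi)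
  with a have "x = a" by (auto simp: cell_def level_def)
  with a show "x \<in> all_cells" by simp
next
  assume "x \<in> all_cells"
  then have "x + (1, 0) \<in> cell_nbrs x"
    by (auto simp: cell_nbrs_def cell_def prod_eq_iff intro!: bexI[of _ x])
  moreover from this have "x + (1, 0) \<in> SG_pos" by (rule cell_nbrs_subset)
  moreover have "level (x + (1, 0)) = n + 1" using n by (simp add: level_def)
  ultimately have "x + (1, 0) \<in> SG - SG_ball n" "adj x (x + (1, 0))"
    using SG_pos_nonneg[of "x + (1, 0)"] by (auto simp: SG_def SG_ball_taxi adj_iff_cell_nbrs)
  moreover have "x \<in> SG_ball n"
    using x n SG_pos_nonneg[of x] by (simp add: SG_ball_taxi SG_def)
  ultimately show "x \<in> inner_boundary n" by (auto simp: inner_boundary_def)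
qed

text \<open>The odometer of the sandpile whose final state fills \<open>B\<^sub>n\<close> with mass 1, except for mass \<open>1/2\<close> on the inner
  boundary.  It vanishes on the whole sphere of radius \<open>n\<close>, also at those points of the sphere that
  are not in the inner boundary; the inclusions in the final theorem depend on this.\<close>

definition ball_odometer :: "nat \<Rightarrow> (vertex \<Rightarrow> real) \<Rightarrow> bool" where
  "ball_odometer n u \<longleftrightarrow>
     (\<forall>x\<in>SG. taxi x < int n \<longrightarrow> 0 < u x) \<and>
     (\<forall>x. x \<notin> SG \<or> int n \<le> taxi x \<longrightarrow> u x = 0) \<and>
     (\<forall>x\<in>SG. x \<noteq> (0, 0) \<longrightarrow> Laplacian u x =
        of_bool (x \<in> SG_ball (int n)) - of_bool (x \<in> inner_boundary (int n)) / 2)"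

lemma ball_odometerD:
  assumes "ball_odometer n u"
  shows "x \<in> SG \<Longrightarrow> taxi x < int n \<Longrightarrow> 0 < u x"
    and "x \<notin> SG \<or> int n \<le> taxi x \<Longrightarrow> u x = 0"
    and "x \<in> SG \<Longrightarrow> x \<noteq> (0, 0) \<Longrightarrow> Laplacian u x =
        of_bool (x \<in> SG_ball (int n)) - of_bool (x \<in> inner_boundary (int n)) / 2"
  using assms unfolding ball_odometer_def by blast+

text \<open>Reflect the function on the positive cone.  The value of the Laplacian at the origin is left open
  here; it is determined by conservation of mass.\<close>

lemma ball_odometer_exists:
  assumes "1 \<le> n"
  shows "\<exists>u. ball_odometer n u"
proof -
  define N where "N = int n"
  obtain k where k: "N < 2 ^ k" using int_less_power_of_two by blast
  then obtain w where w: "cone_odometer k N w"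
    using cone_odometer_exists[of N k] assms by (auto simp: N_def)
  define u where "u = (\<lambda>x. if x \<in> SG_pos then w x else w (- x))"
  have w_out: "w x = 0" if "x \<notin> SG_pos" for x
    using that by (intro cone_odometerD(2)[OF w]) (auto simp: SG_pos_def)
  have u_uminus: "u (- x) = u x" for x
    using SG_pos_inter_uminus[of x] w_out[of x] w_out[of "- x"] by (auto simp: u_def)
  have w_pos: "0 < w x" if "x \<in> SG_pos" "taxi x < N" for x
    using that k SG_pos_nonneg[of x] SG_pos_truncate[of x k] by (intro cone_odometerD(1)[OF w]) auto
  have w_zero: "w x = 0" if "N \<le> level x" for x
    using that by (intro cone_odometerD(2)[OF w]) simp
  have lap_pos: "Laplacian u x = of_bool (x \<in> SG_ball N) - of_bool (x \<in> inner_boundary N) / 2"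
    if x: "x \<in> SG_pos" "x \<noteq> (0, 0)" for x
  proof -
    have in_ball: "x \<in> SG_ball N \<longleftrightarrow> level x \<le> N"
      using x SG_pos_nonneg[of x] by (simp add: SG_ball_taxi SG_def)
    have boundary: "level x = N" if "x \<in> inner_boundary N"
      using inner_boundary_taxi[OF that] x SG_pos_nonneg[of x] by simp
    have "u y = w y" if "y \<in> cell_nbrs x" for y
      using cell_nbrs_subset(2)[OF that] by (simp add: u_def)
    then have "Laplacian u x = Laplacian w x"
      using x by (simp add: Laplacian_def nbrs_SG_pos u_def)
    also have "\<dots> = cell_lap all_cells w x"
      by (rule Laplacian_SG_pos[OF x])
    also have "\<dots> = of_bool (x \<in> SG_ball N) - of_bool (x \<in> inner_boundary N) / 2"
    proof (cases "level x < 2 ^ k")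
      case True
      have "level (x - (1, 0)) < 2 ^ k" "level (x - (0, 1)) < 2 ^ k"
        using True by (simp_all add: level_def)
      then have "cell_lap all_cells w x = sphere_target k N x"
        unfolding cone_odometerD(3)[OF w x(2), symmetric] cell_lap_def using True
        by (simp only: all_cells_truncate)
      also have "\<dots> = of_bool (x \<in> SG_ball N) - of_bool (x \<in> inner_boundary N) / 2"
      proof -
        consider "level x < N" | "level x = N" | "N < level x" by linarith
        then show ?thesis
        proof cases
          case 1
          then show ?thesis
            using boundary in_ball x SG_pos_truncate[OF True] by (auto simp: sphere_target_def)
        next
          case 2
          have "cells_below (cells k) x = 2 - of_bool (x \<in> all_cells)"
            using SG_pos_two_cells[OF x] cells_below_truncate[OF True] by simp
          then show ?thesis
            using 2 in_ball inner_boundary_iff[OF x 2] by (simp add: sphere_target_def)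
        next
          case 3
          then show ?thesis
            using boundary in_ball by (auto simp: sphere_target_def)
        qed
      qed
      finally show ?thesis .
    next
      case False
      then have "cell_lap all_cells w x = 0"
        using k by (simp add: cell_lap_def w_zero level_def)
      moreover have "x \<notin> SG_ball N" "x \<notin> inner_boundary N"
        using False k in_ball boundary by auto
      ultimately show ?thesis by simp
    qed
    finally show ?thesis .
  qed
  have "0 < u x" if "x \<in> SG" "taxi x < N" for x
  proof (cases "x \<in> SG_pos")
    case False
    then have "- x \<in> SG_pos" using that(1) by (auto simp: SG_def)
    with False that(2) w_pos[of "- x"] show ?thesis by (simp add: u_def)
  qed (use that w_pos in \<open>simp add: u_def\<close>)
  moreover have "u x = 0" if "x \<notin> SG \<or> N \<le> taxi x" for x
  proof -
    have *: "w y = 0" if y: "y \<notin> SG \<or> N \<le> taxi y" for y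
      using y w_out[of y] w_zero[of y] SG_pos_nonneg[of y] by (cases "y \<in> SG_pos") (auto simp: SG_def)
    show ?thesis using *[of x] *[of "- x"] that by (simp add: u_def)
  qed
  moreover have "Laplacian u x = of_bool (x \<in> SG_ball N) - of_bool (x \<in> inner_boundary N) / 2"
    if x: "x \<in> SG" "x \<noteq> (0, 0)" for x
    using x(1)
  proof (cases rule: SG_cases)
    case 3
    then show ?thesis
      using lap_pos[of "- x"] Laplacian_uminus[of u x] u_uminus by simp
  qed (use x lap_pos in simp_all)
  ultimately have "ball_odometer n u"
    unfolding ball_odometer_def N_def[symmetric] by blast
  then show ?thesis by blast
qed

text \<open>Conservation of mass: exchange the order of summation and use 4-regularity.\<close>

lemma sum_Laplacian_eq_0:
  assumes u: "\<And>x. x \<notin> SG \<or> n \<le> taxi x \<Longrightarrow> u x = 0"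
  shows "(\<Sum>x\<in>SG_ball n. Laplacian u x) = 0"
proof -
  let ?B = "SG_ball n"
  have "(\<Sum>y | adj x y. u y) = (\<Sum>y | y \<in> ?B \<and> adj x y. u y)" for x
    by (rule sum.mono_neutral_right[OF finite_nbrs]) (auto intro!: u simp: SG_ball_taxi)
  then have "(\<Sum>x\<in>?B. \<Sum>y | adj x y. u y) = (\<Sum>x\<in>?B. \<Sum>y | y \<in> ?B \<and> adj x y. u y)"
    by simp
  also have "\<dots> = (\<Sum>y\<in>?B. \<Sum>x | x \<in> ?B \<and> adj x y. u y)"
    by (intro sum.swap_restrict finite_SG_ball)
  also have "\<dots> = (\<Sum>y\<in>?B. 4 * u y)"
  proof (rule sum.cong[OF refl])
    fix y assume y: "y \<in> ?B"
    show "(\<Sum>x | x \<in> ?B \<and> adj x y. u y) = 4 * u y"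
    proof (cases "n \<le> taxi y")
      case True
      then show ?thesis using u by simp
    next
      case False
      then have "x \<in> ?B" if "adj x y" for x
        using adj_step[of y x] adj_step[of x y] that adj_sym[of x y] by (simp add: SG_ball_taxi)
      then have "{x. x \<in> ?B \<and> adj x y} = {x. adj y x}" using adj_sym by blast
      moreover have "y \<in> SG" using y by (simp add: SG_ball_taxi)
      ultimately show ?thesis by (simp add: SG_regular)
    qed
  qed
  finally show ?thesis
    by (simp add: Laplacian_def sum_subtractf sum_divide_distrib[symmetric] sum_distrib_left[symmetric])
qed

text \<open>The final masses sum to \<open>b_vol n\<close>, and the origin ends with mass 1 because it is an interior point
  of \<open>B\<^sub>n\<close>; by conservation of mass it starts with \<open>b_vol n\<close>.\<close>

lemma ball_odometer_origin:
  assumes u: "ball_odometer n u" and n: "1 \<le> n"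
  shows "Laplacian u (0, 0) = 1 - b_vol n"
proof -
  let ?B = "SG_ball (int n)" and ?S = "inner_boundary (int n)"
  have o: "(0, 0) \<in> ?B" "(0, 0) \<notin> ?S"
    using zero_in_SG n inner_boundary_taxi[of "(0, 0)" "int n"] by (auto simp: SG_ball_taxi taxi_def)
  have "0 = (\<Sum>x\<in>?B. Laplacian u x)"
    by (rule sum_Laplacian_eq_0[symmetric]) (rule ball_odometerD(2)[OF u])
  also have "\<dots> = Laplacian u (0, 0) + (\<Sum>x\<in>?B - {(0, 0)}. Laplacian u x)"
    by (rule sum.remove[OF finite_SG_ball o(1)])
  also have "(\<Sum>x\<in>?B - {(0, 0)}. Laplacian u x) = (\<Sum>x\<in>?B - {(0, 0)}. 1 - of_bool (x \<in> ?S) / 2)"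
    by (intro sum.cong refl) (auto simp: ball_odometerD(3)[OF u] SG_ball_taxi)
  also have "\<dots> = (\<Sum>x\<in>?B. 1 - of_bool (x \<in> ?S) / 2) - 1"
    using sum.remove[OF finite_SG_ball o(1), of "\<lambda>x. 1 - of_bool (x \<in> ?S) / 2 :: real"] o(2) by simp
  also have "(\<Sum>x\<in>?B. 1 - of_bool (x \<in> ?S) / 2) = real (card ?B) - (\<Sum>x\<in>?B. of_bool (x \<in> ?S)) / 2"
    by (simp add: sum_subtractf sum_divide_distrib)
  also have "(\<Sum>x\<in>?B. of_bool (x \<in> ?S) :: real) = real (card ?S)"
    using inner_boundary_subset[of "int n"] finite_SG_ball[of "int n"]
    by (simp add: of_bool_def sum.If_cases Int_absorb1)
  finally show ?thesis by (simp add: b_vol_def)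
qed

section \<open>Size of balls and the maximum principle\<close>

lemma axis_in_cells: "j < 2 ^ k \<Longrightarrow> (int j, 0) \<in> cells k"
proof (induction k arbitrary: j)
  case (Suc k)
  show ?case
  proof (cases "j < 2 ^ k")
    case True
    then show ?thesis using Suc.IH by (simp add: cells_Suc_iff del: cells.simps)
  next
    case False
    then have "(int j, 0) - (2 ^ k, 0) = (int (j - 2 ^ k), 0 :: int)" by simp
    moreover have "(int (j - 2 ^ k), 0) \<in> cells k" using Suc.prems by (intro Suc.IH) simp
    ultimately show ?thesis unfolding cells_Suc_iff by simp
  qed
qed simp

lemma axis_in_SG: "(int j, 0) \<in> SG_pos" "adj (int j, 0) (int (Suc j), 0)"
proof -
  have "(int j, 0) \<in> all_cells"
    using axis_in_cells[OF less_exp] unfolding all_cells_def by blast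
  moreover have "(int j, 0) \<in> cell (int j, 0)" "(int (Suc j), 0) \<in> cell (int j, 0)"
    by (simp_all add: cell_def)
  ultimately have "(int (Suc j), 0) \<in> cell_nbrs (int j, 0)"
    by (auto simp: cell_nbrs_def)
  then show "(int j, 0) \<in> SG_pos" "adj (int j, 0) (int (Suc j), 0)"
    using cell_nbrs_subset(1) by (auto simp: adj_iff_cell_nbrs)
qed

text \<open>Ensures that only finitely many \<open>k\<close> satisfy \<open>b_vol k \<le> m\<close>.\<close>

lemma b_vol_lower: "(real k + 1) / 2 \<le> b_vol k"
proof -
  have "(\<lambda>j. (int j, 0)) ` {..k} \<subseteq> SG_ball (int k)"
    using axis_in_SG(1) by (auto simp: SG_ball_taxi taxi_def SG_def)
  then have "card ((\<lambda>j. (int j, 0 :: int)) ` {..k}) \<le> card (SG_ball (int k))"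
    by (intro card_mono finite_SG_ball)
  also have "card ((\<lambda>j. (int j, 0 :: int)) ` {..k}) = k + 1"
    by (subst card_image) (auto simp: inj_on_def)
  finally have "k + 1 \<le> card (SG_ball (int k))" .
  moreover have "card (inner_boundary (int k)) \<le> card (SG_ball (int k))"
    by (intro card_mono finite_SG_ball inner_boundary_subset)
  ultimately show ?thesis by (simp add: b_vol_def)
qed

text \<open>A positive maximum would spread to all neighbours, hence down to the origin, and from there along
  the axis \<open>(j, 0)\<close> out of the ball.\<close>

lemma subharmonic_nonpos:
  assumes sub: "\<And>x. x \<in> SG \<Longrightarrow> taxi x < n \<Longrightarrow> 0 \<le> Laplacian f x"
    and out: "\<And>x. x \<in> SG \<Longrightarrow> n \<le> taxi x \<Longrightarrow> f x \<le> 0"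
    and x: "x \<in> SG"
  shows "f x \<le> 0"
proof (rule ccontr)
  assume "\<not> f x \<le> 0"
  define M where "M = Max (f ` SG_ball (n - 1))"
  have "taxi x < n" using out[OF x] \<open>\<not> f x \<le> 0\<close> by force
  then have x_ball: "x \<in> SG_ball (n - 1)" using x by (simp add: SG_ball_taxi)
  then have "f x \<le> M" unfolding M_def by (intro Max_ge finite_imageI finite_SG_ball) blast
  then have "0 < M" using \<open>\<not> f x \<le> 0\<close> by linarith
  have le_M: "f y \<le> M" if "y \<in> SG" for y
  proof (cases "taxi y < n")
    case True
    then have "y \<in> SG_ball (n - 1)" using that by (simp add: SG_ball_taxi)
    then show ?thesis unfolding M_def by (intro Max_ge finite_imageI finite_SG_ball) blast
  next
    case False
    then show ?thesis using out[OF that] \<open>0 < M\<close> by simp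
  qed
  have spread: "f z = M" if "y \<in> SG" "f y = M" "adj y z" for y z
  proof -
    have "taxi y < n" using out[OF that(1)] that(2) \<open>0 < M\<close> by force
    then have "4 * M \<le> (\<Sum>z | adj y z. f z)"
      using sub[OF that(1)] that(2) by (simp add: Laplacian_def)
    then have "(\<Sum>z | adj y z. M - f z) \<le> 0"
      using SG_regular[OF that(1)] by (simp add: sum_subtractf)
    moreover have nonneg: "0 \<le> M - f v" if "v \<in> {v. adj y v}" for v
      using le_M adj_step[of y v] that by simp
    ultimately have "(\<Sum>z | adj y z. M - f z) = 0"
      by (intro order_antisym sum_nonneg) auto
    then have "M - f z = 0"
      using sum_nonneg_eq_0_iff[OF finite_nbrs, of y "\<lambda>v. M - f v"] nonneg that(3) by blast
    then show ?thesis by simp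
  qed
  have "M \<in> f ` SG_ball (n - 1)"
    unfolding M_def using x_ball by (intro Max_in finite_imageI finite_SG_ball) blast
  then obtain y where y: "y \<in> SG" "f y = M"
    unfolding SG_ball_taxi by blast
  have to_origin: "f (0, 0) = M" if "y \<in> SG" "f y = M" for y
    using that
  proof (induction "nat (taxi y)" arbitrary: y rule: less_induct)
    case less
    show ?case
    proof (cases "y = (0, 0)")
      case False
      then obtain v where v: "adj y v" "taxi v = taxi y - 1" using SG_pred[OF less.prems(1) False] adj_sym by blast
      moreover have "0 \<le> taxi v" by (simp add: taxi_def)
      ultimately show ?thesis
        using spread[OF less.prems v(1)] adj_step[OF v(1)] by (intro less.hyps) auto
    qed (use less.prems in simp)
  qed
  have "f (int j, 0) = M" for j
  proof (induction j)
    case 0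
    then show ?case using to_origin[OF y] by simp
  next
    case (Suc j)
    have "(int j, 0) \<in> SG" using axis_in_SG(1) by (simp add: SG_def)
    from spread[OF this Suc axis_in_SG(2)] show ?case .
  qed
  from this[of "nat n"] \<open>0 < M\<close> show False
    using out[of "(int (nat n), 0)"] axis_in_SG(1)[of "nat n"]
    by (auto simp: SG_def taxi_def split: if_splits)
qed

section \<open>Least action principle\<close>

lemma Laplacian_indicator_self: "Laplacian (indicator {x}) x = - 1"
proof -
  have "(\<Sum>y | adj x y. indicator {x} y :: real) = 0"
    using not_adj_self by (intro sum.neutral) (auto simp: indicator_def)
  then show ?thesis by (simp add: Laplacian_def)
qed

lemma Laplacian_add_cmult: "Laplacian (\<lambda>y. f y + c * g y) x = Laplacian f x + c * Laplacian g x"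
  by (simp add: Laplacian_def sum.distrib sum_distrib_left[symmetric] algebra_simps)

lemma sand_at_toppled: "sand h \<mu>0 xs (Suc k) (xs (Suc k)) =
    sand h \<mu>0 xs k (xs (Suc k)) - max (sand h \<mu>0 xs k (xs (Suc k)) - h (xs (Suc k))) 0"
  by (simp add: topple_def Laplacian_indicator_self)

lemma emitted_0: "emitted h \<mu>0 xs 0 y = 0"
  by (simp add: emitted_def)

lemma emitted_Suc: "emitted h \<mu>0 xs (Suc k) y = emitted h \<mu>0 xs k y +
    max (sand h \<mu>0 xs k (xs (Suc k)) - h (xs (Suc k))) 0 * indicator {xs (Suc k)} y"
proof (cases "xs (Suc k) = y")
  case True
  have "{j. 1 \<le> j \<and> j \<le> Suc k \<and> xs j = y} = insert (Suc k) {j. 1 \<le> j \<and> j \<le> k \<and> xs j = y}"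
    using True by auto
  then show ?thesis
    unfolding emitted_def using sand_at_toppled[of h \<mu>0 xs k] True by simp
next
  case False
  then have "{j. 1 \<le> j \<and> j \<le> Suc k \<and> xs j = y} = {j. 1 \<le> j \<and> j \<le> k \<and> xs j = y}"
    using le_Suc_eq by auto
  then show ?thesis
    unfolding emitted_def using False by simp
qed

lemma sand_eq_emitted: "sand h \<mu>0 xs k y = \<mu>0 y + Laplacian (emitted h \<mu>0 xs k) y"
proof (induction k arbitrary: y)
  case 0
  show ?case by (simp add: Laplacian_def emitted_0)
next
  case (Suc k)
  have "Laplacian (emitted h \<mu>0 xs (Suc k)) y = Laplacian (emitted h \<mu>0 xs k) y +
      max (sand h \<mu>0 xs k (xs (Suc k)) - h (xs (Suc k))) 0 * Laplacian (indicator {xs (Suc k)}) y"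
    unfolding emitted_Suc by (rule Laplacian_add_cmult)
  then show ?case using Suc by (simp add: topple_def)
qed

text \<open>The least action principle.  If the bound is to be violated first by toppling \<open>x\<close>, then \<open>x\<close> has height
  exactly \<open>h x\<close> afterwards, which expresses the emitted mass at \<open>x\<close> through that of its neighbours; the
  bound for the neighbours then gives the bound at \<open>x\<close>.\<close>

lemma emitted_le_stabilizing:
  assumes xs: "\<And>k. 1 \<le> k \<Longrightarrow> xs k \<in> SG"
    and w: "\<And>y. 0 \<le> w y" "\<And>y. y \<in> SG \<Longrightarrow> \<mu>0 y + Laplacian w y \<le> h y"
  shows "emitted h \<mu>0 xs k y \<le> w y"
proof (induction k arbitrary: y)
  case 0
  show ?case by (simp add: emitted_0 w)
next
  case (Suc k)
  define x where "x = xs (Suc k)"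
  have x: "x \<in> SG" using xs by (simp add: x_def)
  show ?case
  proof (cases "y = x \<and> h x < sand h \<mu>0 xs k x")
    case True
    let ?e = "emitted h \<mu>0 xs (Suc k)"
    have "h x = sand h \<mu>0 xs (Suc k) x"
      using sand_at_toppled[of h \<mu>0 xs k] True by (simp add: x_def)
    also have "\<dots> = \<mu>0 x + (1 / 4 * (\<Sum>z | adj x z. ?e z) - ?e x)"
      by (simp only: sand_eq_emitted Laplacian_def)
    finally have "?e x = \<mu>0 x - h x + 1 / 4 * (\<Sum>z | adj x z. ?e z)" by simp
    also have "(\<Sum>z | adj x z. ?e z) \<le> (\<Sum>z | adj x z. w z)"
    proof (rule sum_mono)
      fix z assume "z \<in> {z. adj x z}"
      then have "z \<noteq> x" using not_adj_self by blast
      then show "?e z \<le> w z" using Suc.IH[of z] by (simp add: emitted_Suc x_def)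
    qed
    finally show ?thesis
      using w(2)[OF x] True by (simp add: Laplacian_def)
  next
    case False
    then have "emitted h \<mu>0 xs (Suc k) y = emitted h \<mu>0 xs k y"
      by (auto simp: emitted_Suc x_def max_def)
    then show ?thesis using Suc.IH by simp
  qed
qed

text \<open>Existence of any stabilizing \<open>w\<close> makes the emitted masses converge.  The limit is stabilizing itself: the
  mass at \<open>x\<close> converges, and it is at most \<open>h x\<close> after each of the infinitely many topplings of \<open>x\<close>.\<close>

lemma odometer_properties:
  assumes xs: "toppling_sequence xs"
    and w: "\<And>y. 0 \<le> w y" "\<And>y. y \<in> SG \<Longrightarrow> \<mu>0 y + Laplacian w y \<le> h y"
  shows "0 \<le> odometer h \<mu>0 xs y"
    and "odometer h \<mu>0 xs y \<le> w y"
    and "x \<in> SG \<Longrightarrow> \<mu>0 x + Laplacian (odometer h \<mu>0 xs) x \<le> h x"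
proof -
  let ?e = "emitted h \<mu>0 xs" and ?u = "odometer h \<mu>0 xs"
  have le_w: "?e k z \<le> w z" for k z
    using xs w by (intro emitted_le_stabilizing) (auto simp: toppling_sequence_def)
  have "incseq (\<lambda>k. ?e k z)" for z
    by (intro incseq_SucI) (simp add: emitted_Suc)
  then have "convergent (\<lambda>k. ?e k z)" for z
    using le_w[of _ z] incseq_convergent[of "\<lambda>k. ?e k z" "w z"] by (metis convergentI)
  then have lim: "(\<lambda>k. ?e k z) \<longlonglongrightarrow> ?u z" for z
    unfolding odometer_def by (simp add: convergent_LIMSEQ_iff)
  show "0 \<le> ?u y"
    using \<open>incseq (\<lambda>k. ?e k y)\<close> incseq_le[OF _ lim, of y 0] by (simp add: emitted_0)
  show "?u y \<le> w y"
    by (rule LIMSEQ_le_const2[OF lim]) (use le_w in blast)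
  assume x: "x \<in> SG"
  have "(\<lambda>k. \<mu>0 x + Laplacian (?e k) x) \<longlonglongrightarrow> \<mu>0 x + Laplacian ?u x"
    unfolding Laplacian_def by (intro tendsto_intros lim)
  then have sand_lim: "(\<lambda>k. sand h \<mu>0 xs k x) \<longlonglongrightarrow> \<mu>0 x + Laplacian ?u x"
    by (simp only: sand_eq_emitted)
  show "\<mu>0 x + Laplacian ?u x \<le> h x"
  proof (rule ccontr)
    assume "\<not> \<mu>0 x + Laplacian ?u x \<le> h x"
    then have "eventually (\<lambda>k. h x < sand h \<mu>0 xs k x) sequentially"
      using order_tendstoD(1)[OF sand_lim] by simp
    then obtain K where K: "\<And>k. K \<le> k \<Longrightarrow> h x < sand h \<mu>0 xs k x"
      unfolding eventually_sequentially by blast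
    have "infinite {k. k \<ge> 1 \<and> xs k = x}"
      using xs x by (simp add: toppling_sequence_def)
    then have "\<not> {k. k \<ge> 1 \<and> xs k = x} \<subseteq> {..<K}"
      using finite_subset by blast
    then obtain k where "K \<le> k" "1 \<le> k" "xs k = x"
      unfolding subset_iff lessThan_iff mem_Collect_eq by (metis not_less)
    then obtain k' where "k = Suc k'" by (cases k) auto
    then have "sand h \<mu>0 xs k x \<le> h x"
      using sand_at_toppled[of h \<mu>0 xs k'] \<open>xs k = x\<close> by simp
    with K[OF \<open>K \<le> k\<close>] show False by simp
  qed
qed

section \<open>The shape of the cluster\<close>

theorem theorem1p1:
  fixes m :: real and n :: nat and xs :: "nat \<Rightarrow> vertex"
  assumes "m \<ge> 0"
    and "n = (if {k. b_vol k \<le> m} = {} then 0 else Max {k. b_vol k \<le> m})"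
    and "toppling_sequence xs"
  defines "S \<equiv> cluster (\<lambda>_. 1) (\<lambda>x. m * indicator {(0, 0)} x) xs"
  shows "SG_ball (int n - 1) \<subseteq> S \<and> S \<subseteq> SG_ball (int n)"
proof -
  let ?init = "\<lambda>x :: vertex. m * indicator {(0, 0)} x"
  define u where "u = odometer (\<lambda>_. 1) ?init xs"
  have S: "S = {z \<in> SG. 0 < u z}" by (simp add: S_def cluster_def u_def)
  have "{k. b_vol k \<le> m} \<subseteq> {..nat \<lceil>2 * m\<rceil>}"
  proof
    fix k assume "k \<in> {k. b_vol k \<le> m}"
    then have "real k \<le> 2 * m" using b_vol_lower[of k] by simp
    then show "k \<in> {..nat \<lceil>2 * m\<rceil>}" by (simp add: le_nat_iff) linarith
  qed
  then have fin: "finite {k. b_vol k \<le> m}" by (rule finite_subset) simp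
  have above: "m < b_vol (Suc n)"
  proof (rule ccontr)
    assume "\<not> m < b_vol (Suc n)"
    then have "Suc n \<in> {k. b_vol k \<le> m}" by simp
    moreover from this have "n = Max {k. b_vol k \<le> m}" using assms(2) by (auto split: if_splits)
    ultimately have "Suc n \<le> n" using Max_ge[OF fin] by simp
    then show False by simp
  qed
  have below: "b_vol n \<le> m" if "1 \<le> n"
    using assms(2) Max_in[OF fin] that by (auto split: if_splits)
  \<comment> \<open>The odometer for mass \<open>b_vol (n + 1)\<close> stabilizes the smaller mass \<open>m\<close>, and it vanishes off \<open>B\<^sub>n\<close>.\<close>
  obtain v where v: "ball_odometer (Suc n) v" using ball_odometer_exists by fastforce
  have v_nonneg: "0 \<le> v x" for x
    using ball_odometerD(1,2)[OF v, of x] by fastforce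
  have "?init x + Laplacian v x \<le> 1" if "x \<in> SG" for x
  proof (cases "x = (0, 0)")
    case True
    then show ?thesis using ball_odometer_origin[OF v] above by simp
  next
    case False
    then show ?thesis using ball_odometerD(3)[OF v that False] by simp
  qed
  note stabilizing = this
  have u: "0 \<le> u y" "u y \<le> v y" "y \<in> SG \<Longrightarrow> ?init y + Laplacian u y \<le> 1" for y
    unfolding u_def
    by (rule odometer_properties[of xs v ?init "\<lambda>_. 1", OF assms(3) v_nonneg stabilizing];
        assumption)+
  have "S \<subseteq> SG_ball (int n)"
  proof
    fix x assume "x \<in> S"
    then have "x \<in> SG" "0 < v x" using u(2)[of x] by (simp_all add: S)
    then show "x \<in> SG_ball (int n)"
      using ball_odometerD(2)[OF v, of x] by (force simp: SG_ball_taxi)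
  qed
  moreover have "SG_ball (int n - 1) \<subseteq> S"
  proof
    fix x assume "x \<in> SG_ball (int n - 1)"
    then have x: "x \<in> SG" "taxi x < int n" by (simp_all add: SG_ball_taxi)
    then have n: "1 \<le> n" by (simp add: taxi_def)
    obtain w where w: "ball_odometer n w" using ball_odometer_exists[OF n] by blast
    \<comment> \<open>Inside \<open>B\<^sub>n\<^sub>-\<^sub>1\<close> the final mass for \<open>w\<close> is 1, which is the most that \<open>u\<close> can leave there, and \<open>w\<close>
       starts from the smaller mass \<open>b_vol n\<close>; outside, \<open>w\<close> vanishes.\<close>
    have "w x + (- 1) * u x \<le> 0"
    proof (rule subharmonic_nonpos[where n = "int n", OF _ _ x(1)])
      fix y assume y: "y \<in> SG" "taxi y < int n"
      have "0 \<le> Laplacian w y - Laplacian u y"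
      proof (cases "y = (0, 0)")
        case True
        then show ?thesis
          using u(3)[OF y(1)] ball_odometer_origin[OF w n] below[OF n] by simp
      next
        case False
        have "y \<in> SG_ball (int n)" "y \<notin> inner_boundary (int n)"
          using y inner_boundary_taxi[of y "int n"] by (auto simp: SG_ball_taxi)
        then show ?thesis
          using u(3)[OF y(1)] ball_odometerD(3)[OF w y(1) False] False by simp
      qed
      then show "0 \<le> Laplacian (\<lambda>x. w x + (- 1) * u x) y"
        unfolding Laplacian_add_cmult by simp
    next
      fix y assume "y \<in> SG" "int n \<le> taxi y"
      then show "w y + (- 1) * u y \<le> 0" using ball_odometerD(2)[OF w, of y] u(1)[of y] by simp
    qed
    moreover have "0 < w x" using ball_odometerD(1)[OF w x] .
    ultimately show "x \<in> S" using x by (simp add: S)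
  qed
  ultimately show ?thesis by blast
qed

end
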